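(* Let $x_0\in\mathcal{X}$. Assume: (i) (Assumption 2) $\inf_{(x,u)\in\mathbb{K},\,r\in\mathscr{R}_c} f^{\gamma}(r\mid x,u)>0$ and $\inf_{(x,u)\in\mathbb{K},\,y\in\mathcal{X}} q^{\gamma}(y\mid x,u)>0$ for every $\gamma\in\mathcal{P}$, and $\inf_{(x,u)\in\mathbb{K}}\mathcal{K}(\rho^{\theta}_{x,u}\mid\rho^{\gamma}_{x,u})>0$ for every $\gamma\in\mathcal{P}$ with $\gamma\neq\theta$; and (ii) (Assumption 4) $\lim_{n\to\infty}\mathbb{R}^{\tau,\theta}_{x_0}(n)$ exists $\mathbb{P}^{\tau,\theta}_{x_0}$-almost surely. Then the (probabilistic) residual regret of Thompson sampling vanishes: $$\lim_{n\to\infty}\mathbb{R}^{\tau,\theta}_{x_0}(n)=0,\qquad \mathbb{P}^{\tau,\theta}_{x_0}\text{-almost surely}.$$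
   Context: Model. $\mathcal{X}$ (states) and $\mathcal{U}$ (controls) are Borel spaces; for each $x\in\mathcal{X}$, $\mathcal{U}(x)\subseteq\mathcal{U}$ is the compact set of admissible controls, $\mathcal{U}=\bigcup_x\mathcal{U}(x)$, and $\mathbb{K}=\{(x,u):x\in\mathcal{X},u\in\mathcal{U}(x)\}$ is measurable in $\mathcal{X}\times\mathcal{U}$. $\mathcal{P}$ is a finite parameter set; $\theta\in\mathcal{P}$ is the fixed true parameter, unknown to the decision-maker. $\mathscr{R}_c\subset\mathbb{R}_+$ is a compact measurable set of rewards. For each $\gamma\in\mathcal{P}$ and $(x,u)\in\mathbb{K}$, $f^\gamma(\cdot\mid x,u)$ is a measurable, continuous (in $r$) probability density on $\mathscr{R}_c$ with respect to a $\sigma$-finite measure $\lambda$, and $q^\gamma(\cdot\mid x,u)$ is a probability density on $\mathcal{X}$ with respect to a $\sigma$-finite measure $\eta$; $Q^\gamma(dy\mid x,u)=q^\gamma(y\mid x,u)\,d\eta(y)$ is the transition law and $r^\gamma(x,u)=\int_{\mathscr{R}_c} r f^\gamma(r\mid x,u)\,d\lambda(r)$ is the expected reward. $\beta\in[0,1)$ is the discount factor. Standing Assumption 1. For every $\gamma\in\mathcal{P}$ the equation $\nu^\gamma(x)=\sup_{u\in\mathcal{U}(x)}\{r^\gamma(x,u)+\beta\int\nu^\gamma(y)Q^\gamma(dy\mid x,u)\}$, $x\in\mathcal{X}$, has a unique solution $\nu^\gamma$, the supremum is attained, and there is a stationary deterministic Markov optimal policy $\mu^\gamma:\mathcal{X}\to\mathcal{U}$,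 $\mu^\gamma(x)\in\mathcal{U}(x)$, attaining it. Moreover $\nu^\gamma(x_0)$ is the supremum, over all admissible randomized history-dependent policies, of the expected total discounted reward $\mathbb{E}[\sum_{t\ge0}\beta^tR_t]$ started from $x_0$ when the true parameter is $\gamma$, and it is achieved by $\mu^\gamma$. Thompson sampling $\tau$. The history at time $t$ is $H_t=(X_0,\Theta_0,U_0,R_0,\dots,X_{t-1},\Theta_{t-1},U_{t-1},R_{t-1},X_t)$. A prior $\pi_0(\cdot\mid h_0)$ on $\mathcal{P}$, $h_0=x_0$, with $\pi_0(\gamma\mid h_0)>0$ for all $\gamma\in\mathcal{P}$ is given. The posterior is $$\pi_t(\gamma\mid H_t)=\frac{\mathcal{L}^\gamma_t(H_t)\pi_0(\gamma\mid h_0)}{\sum_{\gamma'\in\mathcal{P}}\mathcal{L}^{\gamma'}_t(H_t)\pi_0(\gamma'\mid h_0)},\qquad \mathcal{L}^\gamma_t(H_t)=\prod_{s=1}^t f^\gamma(R_{s-1}\mid X_{s-1},U_{s-1})\,q^\gamma(X_s\mid X_{s-1},U_{s-1}).$$ $\mathbb{P}^{\tau,\theta}_{x_0}$ (expectation $\mathbb{E}^{\tau,\theta}_{x_0}$) is the unique probability measure on the space of infinite sequences $(X_0,\Theta_0,U_0,R_0,X_1,\dots)$ such that $X_0=x_0$ a.s. and, for each $t\ge0$: given $H_t$, $\Theta_t$ has law $\pi_t(\cdot\mid H_t)$; $U_t=\mu^{\Theta_t}(X_t)$; given $(H_t,\Theta_t,U_t)$, $R_t$ has density $f^\theta(\cdot\mid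 X_t,U_t)$; given $(H_t,\Theta_t,U_t,R_t)$, $X_{t+1}$ has density $q^\theta(\cdot\mid X_t,U_t)$. Probabilistic residual regret. $\mathbb{R}^{\tau,\theta}_{x_0}(n)=\nu^\theta(X_n)-\mathbb{E}^{\tau,\theta}_{x_0}\big[\sum_{t=n}^\infty\beta^{t-n}R_t\,\big|\,H_n\big]$, a random variable. Relative entropy. $\rho^\gamma_{x,u}$ is the probability measure on $\mathscr{R}_c\times\mathcal{X}$ with density $f^\gamma(r\mid x,u)q^\gamma(y\mid x,u)$ with respect to $\lambda\otimes\eta$, and $\mathcal{K}(\rho^\theta_{x,u}\mid\rho^\gamma_{x,u})=\int\log\big(d\rho^\theta_{x,u}/d\rho^\gamma_{x,u}\big)\,d\rho^\theta_{x,u}$. *)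

theory Defs
  imports "HOL-Probability.Probability"
begin

section \<open>The parametrized control model\<close>

text \<open>The states and the controls are Borel subsets of Polish spaces and carry the trace of the
  Borel sigma-algebra. The base measures $\lambda$ and $\eta$ are
  the fields rew_base and st_base; the value $f^\gamma(r \mid x,u)$ is rew_dens M $\gamma$ x u r, and
  $q^\gamma(y \mid x,u)$ is st_dens M $\gamma$ x u y.\<close>

record ('x, 'u, 'p) control_model =
  States :: "'x set"
  Controls :: "'u set"
  Adm :: "'x \<Rightarrow> 'u set"
  Params :: "'p set"
  Rewards :: "real set"
  rew_base :: "real measure"
  st_base :: "'x measure"
  rew_dens :: "'p \<Rightarrow> 'x \<Rightarrow> 'u \<Rightarrow> real \<Rightarrow> real"
  st_dens :: "'p \<Rightarrow> 'x \<Rightarrow> 'u \<Rightarrow> 'x \<Rightarrow> real"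
  disc :: real

definition state_space :: "('x::topological_space, 'u, 'p) control_model \<Rightarrow> 'x measure" where
  "state_space M = restrict_space borel (States M)"

definition control_space :: "('x, 'u::topological_space, 'p) control_model \<Rightarrow> 'u measure" where
  "control_space M = restrict_space borel (Controls M)"

definition reward_space :: "('x, 'u, 'p) control_model \<Rightarrow> real measure" where
  "reward_space M = restrict_space borel (Rewards M)"

definition adm_pairs :: "('x, 'u, 'p) control_model \<Rightarrow> ('x \<times> 'u) set" where
  "adm_pairs M = {(x, u). x \<in> States M \<and> u \<in> Adm M x}"

definition reward_law :: "('x, 'u, 'p) control_model \<Rightarrow> 'p \<Rightarrow> 'x \<Rightarrow> 'u \<Rightarrow> real measure" where
  "reward_law M \<gamma> x u = density (rew_base M) (\<lambda>r. ennreal (rew_dens M \<gamma> x u r))"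

definition transition_law :: "('x, 'u, 'p) control_model \<Rightarrow> 'p \<Rightarrow> 'x \<Rightarrow> 'u \<Rightarrow> 'x measure" where
  "transition_law M \<gamma> x u = density (st_base M) (\<lambda>y. ennreal (st_dens M \<gamma> x u y))"

definition expected_reward :: "('x, 'u, 'p) control_model \<Rightarrow> 'p \<Rightarrow> 'x \<Rightarrow> 'u \<Rightarrow> real" where
  "expected_reward M \<gamma> x u = (\<integral>r. r * rew_dens M \<gamma> x u r \<partial>rew_base M)"

text \<open>The densities are required to be jointly measurable, so that they define stochastic kernels
  and the likelihoods are random variables.\<close>

locale valid_model =
  fixes M :: "('x::polish_space, 'u::polish_space, 'p) control_model"
  assumes States_borel: "States M \<in> sets borel"
    and Controls_borel: "Controls M \<in> sets borel"
    and Adm_compact: "\<And>x. x \<in> States M \<Longrightarrow> compact (Adm M x)"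
    and Controls_eq: "Controls M = (\<Union>x\<in>States M. Adm M x)"
    and adm_pairs_measurable: "adm_pairs M \<in> sets (state_space M \<Otimes>\<^sub>M control_space M)"
    and Params_finite: "finite (Params M)"
    and Rewards_compact: "compact (Rewards M)"
    and Rewards_nonneg: "Rewards M \<subseteq> {0..}"
    and sets_rew_base: "sets (rew_base M) = sets (reward_space M)"
    and sigma_finite_rew_base: "sigma_finite_measure (rew_base M)"
    and sets_st_base: "sets (st_base M) = sets (state_space M)"
    and sigma_finite_st_base: "sigma_finite_measure (st_base M)"
    and rew_dens_measurable: "\<And>\<gamma>. \<gamma> \<in> Params M \<Longrightarrow>
      (\<lambda>((x, u), r). rew_dens M \<gamma> x u r) \<in> borel_measurable
        (restrict_space (state_space M \<Otimes>\<^sub>M control_space M) (adm_pairs M) \<Otimes>\<^sub>M reward_space M)"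
    and rew_dens_continuous: "\<And>\<gamma> x u. \<gamma> \<in> Params M \<Longrightarrow> (x, u) \<in> adm_pairs M \<Longrightarrow>
      continuous_on (Rewards M) (rew_dens M \<gamma> x u)"
    and rew_dens_nonneg: "\<And>\<gamma> x u r. \<gamma> \<in> Params M \<Longrightarrow> (x, u) \<in> adm_pairs M \<Longrightarrow>
      r \<in> Rewards M \<Longrightarrow> 0 \<le> rew_dens M \<gamma> x u r"
    and reward_law_prob: "\<And>\<gamma> x u. \<gamma> \<in> Params M \<Longrightarrow> (x, u) \<in> adm_pairs M \<Longrightarrow>
      prob_space (reward_law M \<gamma> x u)"
    and st_dens_measurable: "\<And>\<gamma>. \<gamma> \<in> Params M \<Longrightarrow>
      (\<lambda>((x, u), y). st_dens M \<gamma> x u y) \<in> borel_measurable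
        (restrict_space (state_space M \<Otimes>\<^sub>M control_space M) (adm_pairs M) \<Otimes>\<^sub>M state_space M)"
    and st_dens_nonneg: "\<And>\<gamma> x u y. \<gamma> \<in> Params M \<Longrightarrow> (x, u) \<in> adm_pairs M \<Longrightarrow>
      y \<in> States M \<Longrightarrow> 0 \<le> st_dens M \<gamma> x u y"
    and transition_law_prob: "\<And>\<gamma> x u. \<gamma> \<in> Params M \<Longrightarrow> (x, u) \<in> adm_pairs M \<Longrightarrow>
      prob_space (transition_law M \<gamma> x u)"
    and disc_nonneg: "0 \<le> disc M"
    and disc_less_1: "disc M < 1"

section \<open>Conditional laws\<close>

definition sigma_gen :: "'w measure \<Rightarrow> 'v measure \<Rightarrow> ('w \<Rightarrow> 'v) \<Rightarrow> 'w measure" where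
  "sigma_gen P N V = vimage_algebra (space P) V N"

text \<open>Under \<^term>\<open>P\<close>, the random variable \<^term>\<open>Y\<close> with values in \<^term>\<open>L\<close> has conditional law
  \<^term>\<open>\<kappa> \<omega>\<close> given the random variable \<^term>\<open>V\<close> with values in \<^term>\<open>N\<close>.\<close>

definition cond_law ::
  "'w measure \<Rightarrow> 'v measure \<Rightarrow> ('w \<Rightarrow> 'v) \<Rightarrow> 'y measure \<Rightarrow> ('w \<Rightarrow> 'y) \<Rightarrow> ('w \<Rightarrow> 'y measure) \<Rightarrow> bool"
where
  "cond_law P N V L Y \<kappa> \<longleftrightarrow>
    (\<forall>A\<in>sets L. AE \<omega> in P.
      real_cond_exp P (sigma_gen P N V) (indicator (Y -` A \<inter> space P)) \<omega> = measure (\<kappa> \<omega>) A)"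

section \<open>Randomized history-dependent policies\<close>

text \<open>A trajectory is the sequence of the triples $(X_t, U_t, R_t)$. The history
  $(X_0,U_0,R_0,\ldots,X_{t-1},U_{t-1},R_{t-1},X_t)$ is represented by the restriction of the
  trajectory to the times before \<^term>\<open>t\<close>, paired with the state at time \<^term>\<open>t\<close>.\<close>

type_synonym ('x, 'u) traj = "nat \<Rightarrow> 'x \<times> 'u \<times> real"

definition pX :: "nat \<Rightarrow> ('x, 'u) traj \<Rightarrow> 'x" where "pX t \<omega> = fst (\<omega> t)"
definition pU :: "nat \<Rightarrow> ('x, 'u) traj \<Rightarrow> 'u" where "pU t \<omega> = fst (snd (\<omega> t))"
definition pR :: "nat \<Rightarrow> ('x, 'u) traj \<Rightarrow> real" where "pR t \<omega> = snd (snd (\<omega> t))"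

definition pH :: "nat \<Rightarrow> ('x, 'u) traj \<Rightarrow> ('x, 'u) traj \<times> 'x" where
  "pH t \<omega> = (restrict \<omega> {..<t}, pX t \<omega>)"

definition step_space ::
  "('x::topological_space, 'u::topological_space, 'p) control_model \<Rightarrow> ('x \<times> 'u \<times> real) measure"
where
  "step_space M = state_space M \<Otimes>\<^sub>M control_space M \<Otimes>\<^sub>M reward_space M"

definition traj_space ::
  "('x::topological_space, 'u::topological_space, 'p) control_model \<Rightarrow> ('x, 'u) traj measure" where
  "traj_space M = PiM UNIV (\<lambda>_. step_space M)"

definition hist_space ::
  "('x::topological_space, 'u::topological_space, 'p) control_model \<Rightarrow> nat
    \<Rightarrow> (('x, 'u) traj \<times> 'x) measure" where
  "hist_space M t = PiM {..<t} (\<lambda>_. step_space M) \<Otimes>\<^sub>M state_space M"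

definition admissible_policy ::
  "('x::topological_space, 'u::topological_space, 'p) control_model
    \<Rightarrow> (nat \<Rightarrow> ('x, 'u) traj \<times> 'x \<Rightarrow> 'u measure) \<Rightarrow> bool" where
  "admissible_policy M \<phi> \<longleftrightarrow>
    (\<forall>t. \<phi> t \<in> hist_space M t \<rightarrow>\<^sub>M prob_algebra (control_space M) \<and>
      (\<forall>h\<in>space (hist_space M t). measure (\<phi> t h) (Adm M (snd h)) = 1))"

definition stationary_policy ::
  "('x::topological_space, 'u::topological_space, 'p) control_model \<Rightarrow> ('x \<Rightarrow> 'u)
    \<Rightarrow> nat \<Rightarrow> ('x, 'u) traj \<times> 'x \<Rightarrow> 'u measure" where
  "stationary_policy M m t h = return (control_space M) (m (snd h))"

text \<open>\<^term>\<open>P\<close> is the law of the controlled process started from \<^term>\<open>x0\<close> under the policy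
  \<^term>\<open>\<phi>\<close> and the parameter \<^term>\<open>\<gamma>\<close>. For an admissible policy, the conditions determine
  \<^term>\<open>P\<close> uniquely, by the Ionescu-Tulcea theorem.\<close>

definition policy_law ::
  "('x::topological_space, 'u::topological_space, 'p) control_model
    \<Rightarrow> (nat \<Rightarrow> ('x, 'u) traj \<times> 'x \<Rightarrow> 'u measure) \<Rightarrow> 'p \<Rightarrow> 'x \<Rightarrow> ('x, 'u) traj measure \<Rightarrow> bool" where
  "policy_law M \<phi> \<gamma> x0 P \<longleftrightarrow>
    prob_space P \<and> sets P = sets (traj_space M) \<and>
    (AE \<omega> in P. pX 0 \<omega> = x0) \<and>
    (\<forall>t. cond_law P (hist_space M t) (pH t) (control_space M) (pU t) (\<lambda>\<omega>. \<phi> t (pH t \<omega>))) \<and>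
    (\<forall>t. cond_law P (hist_space M t \<Otimes>\<^sub>M control_space M) (\<lambda>\<omega>. (pH t \<omega>, pU t \<omega>))
       (reward_space M) (pR t) (\<lambda>\<omega>. reward_law M \<gamma> (pX t \<omega>) (pU t \<omega>))) \<and>
    (\<forall>t. cond_law P (hist_space M t \<Otimes>\<^sub>M control_space M \<Otimes>\<^sub>M reward_space M)
       (\<lambda>\<omega>. (pH t \<omega>, pU t \<omega>, pR t \<omega>))
       (state_space M) (pX (Suc t)) (\<lambda>\<omega>. transition_law M \<gamma> (pX t \<omega>) (pU t \<omega>)))"

definition total_reward ::
  "('x, 'u, 'p) control_model \<Rightarrow> ('x, 'u) traj measure \<Rightarrow> real" where
  "total_reward M P = (\<integral>\<omega>. (\<Sum>t. disc M ^ t * pR t \<omega>) \<partial>P)"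

section \<open>Optimality equation\<close>

definition bellman_rhs ::
  "('x, 'u, 'p) control_model \<Rightarrow> 'p \<Rightarrow> ('x \<Rightarrow> real) \<Rightarrow> 'x \<Rightarrow> 'u \<Rightarrow> real" where
  "bellman_rhs M \<gamma> v x u =
    expected_reward M \<gamma> x u + disc M * (\<integral>y. v y \<partial>transition_law M \<gamma> x u)"

text \<open>Solutions of the optimality equation are sought among the bounded measurable functions.\<close>

definition bellman_solution ::
  "('x::topological_space, 'u, 'p) control_model \<Rightarrow> 'p \<Rightarrow> ('x \<Rightarrow> real) \<Rightarrow> bool" where
  "bellman_solution M \<gamma> v \<longleftrightarrow>
    v \<in> borel_measurable (state_space M) \<and> bounded (v ` States M) \<and>
    (\<forall>x\<in>States M. v x = (SUP u\<in>Adm M x. bellman_rhs M \<gamma> v x u))"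

text \<open>\<^term>\<open>\<nu> \<gamma>\<close> is the optimal value function and \<^term>\<open>\<mu> \<gamma>\<close> an optimal stationary
  policy for the parameter \<^term>\<open>\<gamma>\<close>.\<close>

definition optimality_assumption ::
  "('x::topological_space, 'u::topological_space, 'p) control_model
    \<Rightarrow> ('p \<Rightarrow> 'x \<Rightarrow> real) \<Rightarrow> ('p \<Rightarrow> 'x \<Rightarrow> 'u) \<Rightarrow> bool" where
  "optimality_assumption M \<nu> \<mu> \<longleftrightarrow>
    (\<forall>\<gamma>\<in>Params M.
      bellman_solution M \<gamma> (\<nu> \<gamma>) \<and>
      (\<forall>w. bellman_solution M \<gamma> w \<longrightarrow> (\<forall>x\<in>States M. w x = \<nu> \<gamma> x)) \<and>
      \<mu> \<gamma> \<in> state_space M \<rightarrow>\<^sub>M control_space M \<and>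
      (\<forall>x\<in>States M. \<mu> \<gamma> x \<in> Adm M x \<and> \<nu> \<gamma> x = bellman_rhs M \<gamma> (\<nu> \<gamma>) x (\<mu> \<gamma> x)) \<and>
      (\<forall>x\<in>States M.
        \<nu> \<gamma> x = Sup {total_reward M P |\<phi> P. admissible_policy M \<phi> \<and> policy_law M \<phi> \<gamma> x P} \<and>
        (\<exists>P. policy_law M (stationary_policy M (\<mu> \<gamma>)) \<gamma> x P \<and> total_reward M P = \<nu> \<gamma> x)))"

section \<open>Thompson sampling\<close>

text \<open>The trajectories under Thompson sampling also record the sampled parameters; they are
  sequences of quadruples $(X_t, \Theta_t, U_t, R_t)$.\<close>

type_synonym ('x, 'u, 'p) ts_traj = "nat \<Rightarrow> 'x \<times> 'p \<times> 'u \<times> real"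

definition tX :: "nat \<Rightarrow> ('x, 'u, 'p) ts_traj \<Rightarrow> 'x" where "tX t \<omega> = fst (\<omega> t)"
definition tTheta :: "nat \<Rightarrow> ('x, 'u, 'p) ts_traj \<Rightarrow> 'p" where "tTheta t \<omega> = fst (snd (\<omega> t))"
definition tU :: "nat \<Rightarrow> ('x, 'u, 'p) ts_traj \<Rightarrow> 'u" where "tU t \<omega> = fst (snd (snd (\<omega> t)))"
definition tR :: "nat \<Rightarrow> ('x, 'u, 'p) ts_traj \<Rightarrow> real" where "tR t \<omega> = snd (snd (snd (\<omega> t)))"

definition tH :: "nat \<Rightarrow> ('x, 'u, 'p) ts_traj \<Rightarrow> ('x, 'u, 'p) ts_traj \<times> 'x" where
  "tH t \<omega> = (restrict \<omega> {..<t}, tX t \<omega>)"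

definition ts_step_space ::
  "('x::topological_space, 'u::topological_space, 'p) control_model
    \<Rightarrow> ('x \<times> 'p \<times> 'u \<times> real) measure" where
  "ts_step_space M =
    state_space M \<Otimes>\<^sub>M count_space (Params M) \<Otimes>\<^sub>M control_space M \<Otimes>\<^sub>M reward_space M"

definition ts_space ::
  "('x::topological_space, 'u::topological_space, 'p) control_model
    \<Rightarrow> ('x, 'u, 'p) ts_traj measure" where
  "ts_space M = PiM UNIV (\<lambda>_. ts_step_space M)"

definition ts_hist_space ::
  "('x::topological_space, 'u::topological_space, 'p) control_model \<Rightarrow> nat
    \<Rightarrow> (('x, 'u, 'p) ts_traj \<times> 'x) measure" where
  "ts_hist_space M t = PiM {..<t} (\<lambda>_. ts_step_space M) \<Otimes>\<^sub>M state_space M"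

definition is_prior ::
  "('x, 'u, 'p) control_model \<Rightarrow> ('x \<Rightarrow> 'p \<Rightarrow> real) \<Rightarrow> bool" where
  "is_prior M \<pi>0 \<longleftrightarrow>
    (\<forall>x\<in>States M. (\<forall>\<gamma>\<in>Params M. 0 < \<pi>0 x \<gamma>) \<and> (\<Sum>\<gamma>\<in>Params M. \<pi>0 x \<gamma>) = 1)"

text \<open>The likelihood and the posterior at time \<^term>\<open>t\<close> are functions of the whole trajectory
  that depend on it only through \<^term>\<open>tH t \<omega>\<close>.\<close>

definition likelihood ::
  "('x, 'u, 'p) control_model \<Rightarrow> 'p \<Rightarrow> nat \<Rightarrow> ('x, 'u, 'p) ts_traj \<Rightarrow> real" where
  "likelihood M \<gamma> t \<omega> =
    (\<Prod>s=1..t. rew_dens M \<gamma> (tX (s - 1) \<omega>) (tU (s - 1) \<omega>) (tR (s - 1) \<omega>) *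
      st_dens M \<gamma> (tX (s - 1) \<omega>) (tU (s - 1) \<omega>) (tX s \<omega>))"

definition posterior ::
  "('x, 'u, 'p) control_model \<Rightarrow> ('x \<Rightarrow> 'p \<Rightarrow> real) \<Rightarrow> nat \<Rightarrow> ('x, 'u, 'p) ts_traj \<Rightarrow> 'p \<Rightarrow> real" where
  "posterior M \<pi>0 t \<omega> \<gamma> =
    likelihood M \<gamma> t \<omega> * \<pi>0 (tX 0 \<omega>) \<gamma> /
    (\<Sum>\<gamma>'\<in>Params M. likelihood M \<gamma>' t \<omega> * \<pi>0 (tX 0 \<omega>) \<gamma>')"

text \<open>\<^term>\<open>P\<close> is the law of the process started from \<^term>\<open>x0\<close> under Thompson sampling and the
  true parameter \<^term>\<open>\<theta>\<close>. Again \<^term>\<open>P\<close> is determined uniquely.\<close>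

definition thompson_law ::
  "('x::topological_space, 'u::topological_space, 'p) control_model
    \<Rightarrow> ('x \<Rightarrow> 'p \<Rightarrow> real) \<Rightarrow> ('p \<Rightarrow> 'x \<Rightarrow> 'u) \<Rightarrow> 'p \<Rightarrow> 'x
    \<Rightarrow> ('x, 'u, 'p) ts_traj measure \<Rightarrow> bool" where
  "thompson_law M \<pi>0 \<mu> \<theta> x0 P \<longleftrightarrow>
    prob_space P \<and> sets P = sets (ts_space M) \<and>
    (AE \<omega> in P. tX 0 \<omega> = x0) \<and>
    (\<forall>t. cond_law P (ts_hist_space M t) (tH t) (count_space (Params M)) (tTheta t)
       (\<lambda>\<omega>. point_measure (Params M) (\<lambda>\<gamma>. ennreal (posterior M \<pi>0 t \<omega> \<gamma>)))) \<and>
    (\<forall>t. AE \<omega> in P. tU t \<omega> = \<mu> (tTheta t \<omega>) (tX t \<omega>)) \<and>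
    (\<forall>t. cond_law P (ts_hist_space M t \<Otimes>\<^sub>M count_space (Params M) \<Otimes>\<^sub>M control_space M)
       (\<lambda>\<omega>. (tH t \<omega>, tTheta t \<omega>, tU t \<omega>))
       (reward_space M) (tR t) (\<lambda>\<omega>. reward_law M \<theta> (tX t \<omega>) (tU t \<omega>))) \<and>
    (\<forall>t. cond_law P
       (ts_hist_space M t \<Otimes>\<^sub>M count_space (Params M) \<Otimes>\<^sub>M control_space M \<Otimes>\<^sub>M reward_space M)
       (\<lambda>\<omega>. (tH t \<omega>, tTheta t \<omega>, tU t \<omega>, tR t \<omega>))
       (state_space M) (tX (Suc t)) (\<lambda>\<omega>. transition_law M \<theta> (tX t \<omega>) (tU t \<omega>)))"

text \<open>The sum over $t \ge n$ of $\beta^{t-n} R_t$ is indexed by $k = t - n$.\<close>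

definition residual_regret ::
  "('x::topological_space, 'u::topological_space, 'p) control_model
    \<Rightarrow> ('p \<Rightarrow> 'x \<Rightarrow> real) \<Rightarrow> 'p \<Rightarrow> ('x, 'u, 'p) ts_traj measure
    \<Rightarrow> nat \<Rightarrow> ('x, 'u, 'p) ts_traj \<Rightarrow> real" where
  "residual_regret M \<nu> \<theta> P n \<omega> =
    \<nu> \<theta> (tX n \<omega>) -
    real_cond_exp P (sigma_gen P (ts_hist_space M n) (tH n))
      (\<lambda>\<omega>'. \<Sum>k. disc M ^ k * tR (n + k) \<omega>') \<omega>"

section \<open>Relative entropy and identifiability\<close>

definition joint_law :: "('x, 'u, 'p) control_model \<Rightarrow> 'p \<Rightarrow> 'x \<Rightarrow> 'u \<Rightarrow> (real \<times> 'x) measure" where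
  "joint_law M \<gamma> x u =
    density (rew_base M \<Otimes>\<^sub>M st_base M)
      (\<lambda>(r, y). ennreal (rew_dens M \<gamma> x u r * st_dens M \<gamma> x u y))"

text \<open>The relative entropy of \<^term>\<open>A\<close> with respect to \<^term>\<open>B\<close>, with values in the extended reals.
  The negative part of the logarithm of $dA/dB$ is always integrable with respect to \<^term>\<open>A\<close>, so
  that the integral is infinite if it does not exist as a finite one; \<^const>\<open>KL_divergence\<close>
  is $0$ in this case. Note its order of arguments.\<close>

definition relative_entropy :: "'a measure \<Rightarrow> 'a measure \<Rightarrow> ereal" where
  "relative_entropy A B =
    (if absolutely_continuous B A \<and> integrable A (entropy_density (exp 1) B A)
     then ereal (KL_divergence (exp 1) B A) else \<infinity>)"

definition identifiability_assumption ::
  "('x, 'u, 'p) control_model \<Rightarrow> 'p \<Rightarrow> bool" where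
  "identifiability_assumption M \<theta> \<longleftrightarrow>
    (\<forall>\<gamma>\<in>Params M.
      0 < (INF ((x, u), r)\<in>adm_pairs M \<times> Rewards M. rew_dens M \<gamma> x u r) \<and>
      0 < (INF ((x, u), y)\<in>adm_pairs M \<times> States M. st_dens M \<gamma> x u y)) \<and>
    (\<forall>\<gamma>\<in>Params M. \<gamma> \<noteq> \<theta> \<longrightarrow>
      0 < (INF (x, u)\<in>adm_pairs M. relative_entropy (joint_law M \<theta> x u) (joint_law M \<gamma> x u)))"

end

theory Submission
  imports Defs
begin

text \<open>
  A posterior weight $\pi_t(\gamma)$ with $\gamma \neq \theta$ is at most a constant times the square
  root $Z_t$ of the likelihood ratio of $\gamma$ against $\theta$, and one step multiplies $Z_t$ in
  conditional mean by the Hellinger affinity of the joint reward and transition densities. The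
  affinity is below one at each pair $(x,u)$, because the relative entropy is positive there, but in
  general not uniformly, since the densities need not be bounded above. The lower bound on the
  densities compensates for this: from every pair, the next state falls with probability bounded below
  into a set where the affinity is bounded away from one for all recommended controls. So the mean of
  $Z_t$ contracts over two steps, and the probability that $\Theta_t \neq \theta$ tends to zero.

  By the optimality equation, the residual regret is the conditional expectation of the discounted
  sum of the discrepancies, which are bounded and vanish whenever $\Theta_t = \theta$. Hence
  it tends to zero in $L^1$, and its almost sure limit must be zero.
\<close>

section \<open>Disintegration of conditional laws\<close>

text \<open>The square root is taken because log-likelihood ratios need not be integrable here (the
  relative entropy may be infinite), whereas the root ratio has mean at most one without any moment
  bound. Its deficit from one is a squared Hellinger distance, which vanishes only if the two joint
  laws coincide. Two measurability obstacles shape the formal argument. A conditional law is known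
  only up to a null set that depends on the event, so it is first turned into an identity of
  measures on a product space, after which the inner integrals use the kernel at every sample point.
  And the densities are measurable only over the admissible pairs, while the played control equals
  the recommended one only almost surely, so all kernels are evaluated at the recommended pair
  \<open>XU\<close>. The regret bound uses only the probability of each wrong draw, not almost sure
  convergence of the posterior: a conditional expectation is hard to control pathwise but easy in
  $L^1$, by duality with its sign.\<close>

lemma measurable_sigma_gen:
  assumes "V \<in> P \<rightarrow>\<^sub>M N" "f \<in> N \<rightarrow>\<^sub>M L"
  shows "(\<lambda>\<omega>. f (V \<omega>)) \<in> sigma_gen P N V \<rightarrow>\<^sub>M L"
  unfolding sigma_gen_def
  by (rule measurable_compose[OF measurable_vimage_algebra1 assms(2)])
    (use measurable_space[OF assms(1)] in blast)

lemma space_sigma_gen [simp]: "space (sigma_gen P N V) = space P"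
  by (simp add: sigma_gen_def)

lemma sets_sigma_gen_subset:
  assumes "V \<in> G \<rightarrow>\<^sub>M N" "space G = space P"
  shows "sets (sigma_gen P N V) \<subseteq> sets G"
  unfolding sigma_gen_def assms(2)[symmetric] by (rule sets_image_in_sets) (simp_all add: assms)

lemma subalgebra_sigma_gen: "V \<in> P \<rightarrow>\<^sub>M N \<Longrightarrow> subalgebra P (sigma_gen P N V)"
  by (simp add: subalgebra_def sets_sigma_gen_subset)

lemma measurable_subset_sets:
  "sets F \<subseteq> sets G \<Longrightarrow> space F = space G \<Longrightarrow> f \<in> F \<rightarrow>\<^sub>M L \<Longrightarrow> f \<in> G \<rightarrow>\<^sub>M L"
  by (auto simp: measurable_def)

lemma (in prob_space) abs_integral_le_const:
  fixes f :: "'a \<Rightarrow> real"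
  assumes [measurable]: "f \<in> borel_measurable M" and le: "\<And>x. x \<in> space M \<Longrightarrow> \<bar>f x\<bar> \<le> c"
  shows "\<bar>\<integral>x. f x \<partial>M\<bar> \<le> c"
proof -
  have int: "integrable M f" by (rule integrable_const_bound[where B = c]) (auto simp: le)
  have "AE x in M. f x \<le> c" "AE x in M. - c \<le> f x"
    by (rule AE_I2, use le in \<open>force simp: abs_le_iff\<close>)+
  then have "(\<integral>x. f x \<partial>M) \<le> c" "- c \<le> (\<integral>x. f x \<partial>M)"
    by (simp_all add: integral_le_const[OF int] integral_ge_const[OF int])
  then show ?thesis by (simp add: abs_le_iff)
qed

text \<open>Both sides are finite measures, so it suffices to compare them on rectangles
  \<open>a \<times> b\<close> with \<open>a\<close> in \<open>F\<close>. This pi-system generates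
  the product sigma-algebra, and each rectangle involves a single event \<open>b\<close>; hence the
  null set in \<open>cond\<close>, which may change with the event, does no harm.\<close>

lemma disintegration:
  fixes k :: "'w \<times> 'y \<Rightarrow> ennreal"
  assumes "prob_space P" and sub: "subalgebra P F" and Y [measurable]: "Y \<in> P \<rightarrow>\<^sub>M L"
    and "sigma_finite_measure B" and sets_B [measurable_cong]: "sets B = sets L"
    and k [measurable]: "k \<in> borel_measurable (F \<Otimes>\<^sub>M B)"
    and k_prob: "\<And>\<omega>. \<omega> \<in> space P \<Longrightarrow> prob_space (density B (\<lambda>y. k (\<omega>, y)))"
    and cond: "\<And>A. A \<in> sets L \<Longrightarrow> AE \<omega> in P. real_cond_exp P F (indicator (Y -` A \<inter> space P)) \<omega>
      = measure (density B (\<lambda>y. k (\<omega>, y))) A"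
  shows "distr P (F \<Otimes>\<^sub>M L) (\<lambda>\<omega>. (\<omega>, Y \<omega>)) = density (restr_to_subalg P F \<Otimes>\<^sub>M B) k"
proof -
  interpret P: prob_space P by fact
  interpret B: sigma_finite_measure B by fact
  interpret F: finite_measure_subalgebra P F by unfold_locales fact
  let ?F = "restr_to_subalg P F"
  note [measurable_cong] = sets_restr_to_subalg[OF sub]
  have sp [simp]: "space F = space P" "space B = space L"
    using sub sets_eq_imp_space_eq[OF sets_B] by (auto simp: subalgebra_def)
  have id [measurable]: "(\<lambda>\<omega>. \<omega>) \<in> P \<rightarrow>\<^sub>M F"
    using sub by (auto simp: subalgebra_def measurable_def)
  let ?\<mu> = "distr P (F \<Otimes>\<^sub>M L) (\<lambda>\<omega>. (\<omega>, Y \<omega>))"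
  show ?thesis
  proof (rule measure_eqI_generator_eq[OF Int_stable_pair_measure_generator[of F L],
        where A = "\<lambda>_. space F \<times> space L" and \<Omega> = "space F \<times> space L"])
    show "{a \<times> b |a b. a \<in> sets F \<and> b \<in> sets L} \<subseteq> Pow (space F \<times> space L)"
      by (rule pair_measure_closed)
    show "sets ?\<mu> = sigma_sets (space F \<times> space L) {a \<times> b |a b. a \<in> sets F \<and> b \<in> sets L}"
      by (simp add: sets_pair_measure)
    have "sets (density (?F \<Otimes>\<^sub>M B) k) = sets (F \<Otimes>\<^sub>M L)"
      by (simp add: sets_B sets_restr_to_subalg[OF sub] cong: sets_pair_measure_cong)
    then show "sets (density (?F \<Otimes>\<^sub>M B) k) =
        sigma_sets (space F \<times> space L) {a \<times> b |a b. a \<in> sets F \<and> b \<in> sets L}"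
      by (simp add: sets_pair_measure)
    show "range (\<lambda>_. space F \<times> space L) \<subseteq> {a \<times> b |a b. a \<in> sets F \<and> b \<in> sets L}"
      by blast
    show "emeasure ?\<mu> (space F \<times> space L) \<noteq> \<infinity>"
      by (rule finite_measure.emeasure_finite[OF P.finite_measure_distr,
            unfolded infinity_ennreal_def[symmetric]]) measurable
    fix Z assume "Z \<in> {a \<times> b |a b. a \<in> sets F \<and> b \<in> sets L}"
    then obtain a b where Z: "Z = a \<times> b" and [measurable]: "a \<in> sets F" "b \<in> sets L" by auto
    have a': "a \<in> sets P" using sub \<open>a \<in> sets F\<close> by (auto simp: subalgebra_def)
    have [measurable]: "Y -` b \<inter> space P \<in> sets P" by measurable
    have [measurable]: "b \<in> sets B" using sets_B by simp
    have km: "(\<lambda>\<omega>. measure (density B (\<lambda>y. k (\<omega>, y))) b) \<in> borel_measurable F"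
    proof -
      have "(\<lambda>\<omega>. enn2real (\<integral>\<^sup>+y. k (\<omega>, y) * indicator b y \<partial>B)) \<in> borel_measurable F"
        by measurable
      then show ?thesis
        by (rule measurable_cong[THEN iffD1, rotated])
          (simp add: measure_def emeasure_density)
    qed
    have m1: "(\<lambda>\<omega>. measure (density B (\<lambda>y. k (\<omega>, y))) b) \<in> borel_measurable P"
      using measurable_from_subalg[OF sub km] .
    have intm: "integrable P (\<lambda>\<omega>. indicator a \<omega> *\<^sub>R measure (density B (\<lambda>y. k (\<omega>, y))) b)"
      using a' m1 k_prob
      by (intro P.integrable_const_bound[where B = 1])
        (auto simp: indicator_def intro!: prob_space.prob_le_1)
    have "emeasure ?\<mu> Z = emeasure P (a \<inter> (Y -` b \<inter> space P))"
      unfolding Z using sets.sets_into_space[OF a']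
      by (subst emeasure_distr) (auto intro!: arg_cong[where f = "emeasure P"])
    also have "\<dots> = ennreal (\<integral>\<omega>\<in>a. indicator (Y -` b \<inter> space P) \<omega> \<partial>P)"
      using a' by (simp add: set_lebesgue_integral_def P.emeasure_eq_measure indicator_inter_arith[symmetric])
    \<comment> \<open>The defining property of the conditional expectation applies because
      \<open>a\<close> lies in \<open>F\<close>.\<close>
    also have "(\<integral>\<omega>\<in>a. indicator (Y -` b \<inter> space P) \<omega> \<partial>P)
        = (\<integral>\<omega>\<in>a. real_cond_exp P F (indicator (Y -` b \<inter> space P)) \<omega> \<partial>P)"
      by (rule F.real_cond_exp_intA) (auto intro!: P.integrable_const_bound[where B = 1])
    also have "\<dots> = (\<integral>\<omega>\<in>a. measure (density B (\<lambda>y. k (\<omega>, y))) b \<partial>P)"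
      unfolding set_lebesgue_integral_def using cond[OF \<open>b \<in> sets L\<close>] a' m1
      by (intro integral_cong_AE) auto
    also have "ennreal \<dots> = (\<integral>\<^sup>+\<omega>. indicator a \<omega> * ennreal (measure (density B (\<lambda>y. k (\<omega>, y))) b) \<partial>P)"
      unfolding set_lebesgue_integral_def using intm
      by (subst nn_integral_eq_integral[symmetric])
        (auto intro!: nn_integral_cong simp: indicator_def)
    also have "\<dots> = (\<integral>\<^sup>+\<omega>. (\<integral>\<^sup>+y. k (\<omega>, y) * indicator Z (\<omega>, y) \<partial>B) \<partial>P)"
    proof (rule nn_integral_cong)
      fix \<omega> assume \<omega>: "\<omega> \<in> space P"
      interpret K: prob_space "density B (\<lambda>y. k (\<omega>, y))" using k_prob[OF \<omega>] .
      have [measurable]: "(\<lambda>y. k (\<omega>, y)) \<in> borel_measurable B"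
        using \<omega> by (intro measurable_compose[OF measurable_Pair1' k]) auto
      show "indicator a \<omega> * ennreal (measure (density B (\<lambda>y. k (\<omega>, y))) b) =
          (\<integral>\<^sup>+y. k (\<omega>, y) * indicator Z (\<omega>, y) \<partial>B)"
        by (auto simp: K.emeasure_eq_measure[symmetric] emeasure_density Z indicator_def)
    qed
    also have "\<dots> = (\<integral>\<^sup>+\<omega>. (\<integral>\<^sup>+y. k (\<omega>, y) * indicator Z (\<omega>, y) \<partial>B) \<partial>?F)"
      unfolding Z by (subst nn_integral_subalgebra2[OF sub]) auto
    also have "\<dots> = emeasure (density (?F \<Otimes>\<^sub>M B) k) Z"
      unfolding Z by (subst emeasure_density, measurable) (subst B.nn_integral_fst[symmetric], auto)
    finally show "emeasure ?\<mu> Z = emeasure (density (?F \<Otimes>\<^sub>M B) k) Z" .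
  qed blast
qed

lemma disintegration_nn_integral:
  fixes k :: "'w \<times> 'y \<Rightarrow> ennreal" and g :: "'w \<times> 'y \<Rightarrow> ennreal"
  assumes "prob_space P" and sub: "subalgebra P F" and Y [measurable]: "Y \<in> P \<rightarrow>\<^sub>M L"
    and "sigma_finite_measure B" and sets_B [measurable_cong]: "sets B = sets L"
    and k [measurable]: "k \<in> borel_measurable (F \<Otimes>\<^sub>M B)"
    and eq: "distr P (F \<Otimes>\<^sub>M L) (\<lambda>\<omega>. (\<omega>, Y \<omega>)) = density (restr_to_subalg P F \<Otimes>\<^sub>M B) k"
    and g [measurable]: "g \<in> borel_measurable (F \<Otimes>\<^sub>M L)"
  shows "(\<integral>\<^sup>+\<omega>. g (\<omega>, Y \<omega>) \<partial>P) = (\<integral>\<^sup>+\<omega>. (\<integral>\<^sup>+y. k (\<omega>, y) * g (\<omega>, y) \<partial>B) \<partial>P)"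
proof -
  interpret B: sigma_finite_measure B by fact
  note [measurable_cong] = sets_restr_to_subalg[OF sub]
  have [measurable]: "(\<lambda>\<omega>. \<omega>) \<in> P \<rightarrow>\<^sub>M F"
    using sub by (auto simp: subalgebra_def measurable_def)
  have "(\<integral>\<^sup>+\<omega>. g (\<omega>, Y \<omega>) \<partial>P) = (\<integral>\<^sup>+z. g z \<partial>distr P (F \<Otimes>\<^sub>M L) (\<lambda>\<omega>. (\<omega>, Y \<omega>)))"
    by (simp add: nn_integral_distr)
  also have "\<dots> = (\<integral>\<^sup>+z. k z * g z \<partial>(restr_to_subalg P F \<Otimes>\<^sub>M B))"
    unfolding eq by (rule nn_integral_density) measurable
  also have "\<dots> = (\<integral>\<^sup>+\<omega>. (\<integral>\<^sup>+y. k (\<omega>, y) * g (\<omega>, y) \<partial>B) \<partial>restr_to_subalg P F)"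
    by (rule B.nn_integral_fst[symmetric]) measurable
  also have "\<dots> = (\<integral>\<^sup>+\<omega>. (\<integral>\<^sup>+y. k (\<omega>, y) * g (\<omega>, y) \<partial>B) \<partial>P)"
    by (rule nn_integral_subalgebra2[OF sub]) measurable
  finally show ?thesis .
qed

text \<open>Boundedness of \<open>g\<close> makes it integrable under the joint law, hence
  \<open>k * g\<close> integrable for the product measure, and Fubini applies to the signed
  integrand. Used for rewards and values, whose weights change sign.\<close>

lemma disintegration_integral:
  fixes k :: "'w \<times> 'y \<Rightarrow> real" and g :: "'w \<times> 'y \<Rightarrow> real"
  assumes "prob_space P" and sub: "subalgebra P F" and Y [measurable]: "Y \<in> P \<rightarrow>\<^sub>M L"
    and "sigma_finite_measure B" and sets_B [measurable_cong]: "sets B = sets L"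
    and k [measurable]: "k \<in> borel_measurable (F \<Otimes>\<^sub>M B)"
    and k_nonneg: "\<And>\<omega> y. \<omega> \<in> space P \<Longrightarrow> y \<in> space L \<Longrightarrow> 0 \<le> k (\<omega>, y)"
    and eq: "distr P (F \<Otimes>\<^sub>M L) (\<lambda>\<omega>. (\<omega>, Y \<omega>)) = density (restr_to_subalg P F \<Otimes>\<^sub>M B) k"
    and g [measurable]: "g \<in> borel_measurable (F \<Otimes>\<^sub>M L)"
    and bounded: "\<And>\<omega> y. \<omega> \<in> space P \<Longrightarrow> y \<in> space L \<Longrightarrow> \<bar>g (\<omega>, y)\<bar> \<le> C"
  shows "(\<integral>\<omega>. g (\<omega>, Y \<omega>) \<partial>P) = (\<integral>\<omega>. (\<integral>y. k (\<omega>, y) * g (\<omega>, y) \<partial>B) \<partial>P)"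
proof -
  interpret P: prob_space P by fact
  interpret B: sigma_finite_measure B by fact
  interpret F: prob_space "restr_to_subalg P F"
    by (rule prob_space_restr_to_subalg) fact+
  interpret FB: pair_sigma_finite "restr_to_subalg P F" B ..
  note [measurable_cong] = sets_restr_to_subalg[OF sub]
  have [measurable]: "(\<lambda>\<omega>. \<omega>) \<in> P \<rightarrow>\<^sub>M F"
    using sub by (auto simp: subalgebra_def measurable_def)
  have sp: "space (restr_to_subalg P F \<Otimes>\<^sub>M B) = space P \<times> space L" "space (F \<Otimes>\<^sub>M L) = space P \<times> space L"
    using sub sets_eq_imp_space_eq[OF sets_B] by (auto simp: space_pair_measure space_restr_to_subalg subalgebra_def)
  have [simp]: "AE z in restr_to_subalg P F \<Otimes>\<^sub>M B. 0 \<le> k z"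
    by (rule AE_I2) (auto simp: sp k_nonneg)
  interpret D: prob_space "distr P (F \<Otimes>\<^sub>M L) (\<lambda>\<omega>. (\<omega>, Y \<omega>))"
    by (rule P.prob_space_distr) measurable
  have "integrable (distr P (F \<Otimes>\<^sub>M L) (\<lambda>\<omega>. (\<omega>, Y \<omega>))) g"
    by (rule D.integrable_const_bound[where B = C]) (auto simp: sp bounded)
  then have int: "integrable (restr_to_subalg P F \<Otimes>\<^sub>M B) (\<lambda>z. k z * g z)"
    unfolding eq by (subst (asm) integrable_real_density) auto
  have "(\<integral>\<omega>. g (\<omega>, Y \<omega>) \<partial>P) = (\<integral>z. g z \<partial>distr P (F \<Otimes>\<^sub>M L) (\<lambda>\<omega>. (\<omega>, Y \<omega>)))"
    by (simp add: integral_distr)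
  also have "\<dots> = (\<integral>z. k z * g z \<partial>(restr_to_subalg P F \<Otimes>\<^sub>M B))"
    unfolding eq by (subst integral_real_density) auto
  also have "\<dots> = (\<integral>\<omega>. (\<integral>y. k (\<omega>, y) * g (\<omega>, y) \<partial>B) \<partial>restr_to_subalg P F)"
    using FB.integral_fst'[OF int] by simp
  also have "\<dots> = (\<integral>\<omega>. (\<integral>y. k (\<omega>, y) * g (\<omega>, y) \<partial>B) \<partial>P)"
    by (rule integral_subalgebra2[OF sub]) measurable
  finally show ?thesis .
qed

text \<open>The constant 1 is a density of \<open>D\<close> with respect to itself, and
  sigma-finiteness makes such a density unique almost everywhere. This is what rules out equal joint
  laws for distinct parameters.\<close>

lemma relative_entropy_self:
  assumes "sigma_finite_measure D"
  shows "relative_entropy D D = 0"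
proof -
  interpret sigma_finite_measure D by fact
  have "AE x in D. 1 = RN_deriv D D x"
    by (rule RN_deriv_unique) (simp_all add: density_1)
  then have "AE x in D. entropy_density (exp 1) D D x = 0"
    by eventually_elim (simp add: entropy_density_def flip: one_ennreal.rep_eq)
  then have "integrable D (entropy_density (exp 1) D D)"
    by (subst integrable_cong_AE[where g = "\<lambda>_. 0"]) auto
  then show ?thesis
    by (simp add: relative_entropy_def absolutely_continuous_def KL_same_eq_0)
qed

text \<open>Fatou's lemma gives a vanishing lower limit of the absolute values almost surely; where
  the sequence converges, its limit has this lower limit as absolute value. Convergence in $L^1$
  alone would give zero only along a subsequence.\<close>

lemma AE_tendsto_0_of_nn_integral:
  fixes f :: "nat \<Rightarrow> 'w \<Rightarrow> real"
  assumes [measurable]: "\<And>n. f n \<in> borel_measurable M"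
    and lim: "(\<lambda>n. \<integral>\<^sup>+\<omega>. ennreal \<bar>f n \<omega>\<bar> \<partial>M) \<longlonglongrightarrow> 0"
    and ex: "AE \<omega> in M. \<exists>L. (\<lambda>n. f n \<omega>) \<longlonglongrightarrow> L"
  shows "AE \<omega> in M. (\<lambda>n. f n \<omega>) \<longlonglongrightarrow> 0"
proof -
  have "(\<integral>\<^sup>+\<omega>. liminf (\<lambda>n. ennreal \<bar>f n \<omega>\<bar>) \<partial>M) \<le> liminf (\<lambda>n. \<integral>\<^sup>+\<omega>. ennreal \<bar>f n \<omega>\<bar> \<partial>M)"
    by (rule nn_integral_liminf) measurable
  also have "\<dots> = 0"
    using lim_imp_Liminf[OF _ lim] by simp
  finally have "AE \<omega> in M. liminf (\<lambda>n. ennreal \<bar>f n \<omega>\<bar>) = 0"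
    by (subst (asm) le_zero_eq, subst (asm) nn_integral_0_iff_AE) measurable
  with ex show ?thesis
  proof eventually_elim
    case (elim \<omega>)
    then obtain L where L: "(\<lambda>n. f n \<omega>) \<longlonglongrightarrow> L" by blast
    have "(\<lambda>n. ennreal \<bar>f n \<omega>\<bar>) \<longlonglongrightarrow> ennreal \<bar>L\<bar>"
      by (intro tendsto_ennrealI tendsto_rabs L)
    from lim_imp_Liminf[OF _ this] elim have "L = 0" by simp
    with L show ?case by simp
  qed
qed

section \<open>Densities and Hellinger affinity\<close>

locale thompson_sampling = valid_model M
  for M :: "('x::polish_space, 'u::polish_space, 'p) control_model" +
  fixes \<nu> :: "'p \<Rightarrow> 'x \<Rightarrow> real" and \<mu> :: "'p \<Rightarrow> 'x \<Rightarrow> 'u" and \<pi>0 :: "'x \<Rightarrow> 'p \<Rightarrow> real"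
    and \<theta> :: 'p and x0 :: 'x and P :: "('x, 'u, 'p) ts_traj measure"
  assumes \<theta> [simp]: "\<theta> \<in> Params M"
    and opt: "optimality_assumption M \<nu> \<mu>"
    and prior: "is_prior M \<pi>0"
    and x0: "x0 \<in> States M"
    and law: "thompson_law M \<pi>0 \<mu> \<theta> x0 P"
    and ident: "identifiability_assumption M \<theta>"
begin

abbreviation adm_space :: "('x \<times> 'u) measure" where
  "adm_space \<equiv> restrict_space (state_space M \<Otimes>\<^sub>M control_space M) (adm_pairs M)"

abbreviation base :: "(real \<times> 'x) measure" where
  "base \<equiv> rew_base M \<Otimes>\<^sub>M st_base M"

section \<open>Measurability, normalization and lower bounds of the densities\<close>

lemma space_state_space [simp]: "space (state_space M) = States M"
  by (simp add: state_space_def space_restrict_space)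

lemma space_control_space [simp]: "space (control_space M) = Controls M"
  by (simp add: control_space_def space_restrict_space)

lemma space_reward_space [simp]: "space (reward_space M) = Rewards M"
  by (simp add: reward_space_def space_restrict_space)

lemma space_rew_base [simp]: "space (rew_base M) = Rewards M"
  using sets_eq_imp_space_eq[OF sets_rew_base] by simp

lemma space_st_base [simp]: "space (st_base M) = States M"
  using sets_eq_imp_space_eq[OF sets_st_base] by simp

lemma space_adm_space [simp]: "space adm_space = adm_pairs M"
  using Controls_eq by (auto simp: space_restrict_space space_pair_measure adm_pairs_def)

declare sets_rew_base [measurable_cong] sets_st_base [measurable_cong]

text \<open>The model makes the densities measurable only over the admissible pairs, so the state
  and control must enter through one map into \<open>adm_space\<close>, not through two separate
  coordinates.\<close>

lemma rew_dens_compose: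
  assumes "\<gamma> \<in> Params M" "f \<in> N \<rightarrow>\<^sub>M adm_space" "g \<in> N \<rightarrow>\<^sub>M reward_space M"
  shows "(\<lambda>n. rew_dens M \<gamma> (fst (f n)) (snd (f n)) (g n)) \<in> borel_measurable N"
  using measurable_compose[OF measurable_Pair[OF assms(2,3)] rew_dens_measurable[OF assms(1)]]
  by (simp add: case_prod_beta)

lemma st_dens_compose:
  assumes "\<gamma> \<in> Params M" "f \<in> N \<rightarrow>\<^sub>M adm_space" "g \<in> N \<rightarrow>\<^sub>M state_space M"
  shows "(\<lambda>n. st_dens M \<gamma> (fst (f n)) (snd (f n)) (g n)) \<in> borel_measurable N"
  using measurable_compose[OF measurable_Pair[OF assms(2,3)] st_dens_measurable[OF assms(1)]]
  by (simp add: case_prod_beta)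

lemma adm_space_const: "z \<in> adm_pairs M \<Longrightarrow> (\<lambda>_. z) \<in> N \<rightarrow>\<^sub>M adm_space"
  by (rule measurable_const) simp

lemma rew_dens_section:
  assumes "\<gamma> \<in> Params M" "(x, u) \<in> adm_pairs M"
  shows "rew_dens M \<gamma> x u \<in> borel_measurable (reward_space M)"
  using rew_dens_compose[OF assms(1) adm_space_const[OF assms(2)] measurable_ident] by simp

lemma st_dens_section:
  assumes "\<gamma> \<in> Params M" "(x, u) \<in> adm_pairs M"
  shows "st_dens M \<gamma> x u \<in> borel_measurable (state_space M)"
  using st_dens_compose[OF assms(1) adm_space_const[OF assms(2)] measurable_ident] by simp

lemma nn_integral_rew_dens:
  assumes "\<gamma> \<in> Params M" "(x, u) \<in> adm_pairs M"
  shows "(\<integral>\<^sup>+r. ennreal (rew_dens M \<gamma> x u r) \<partial>rew_base M) = 1"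
proof -
  interpret prob_space "reward_law M \<gamma> x u" by (rule reward_law_prob) fact+
  note [measurable] = rew_dens_section[OF assms]
  have "(\<integral>\<^sup>+r. ennreal (rew_dens M \<gamma> x u r) \<partial>rew_base M)
      = emeasure (reward_law M \<gamma> x u) (space (rew_base M))"
    using sets.top[of "rew_base M"] unfolding reward_law_def by (subst emeasure_density) (auto intro!: nn_integral_cong)
  then show ?thesis
    using emeasure_space_1 by (simp add: reward_law_def)
qed

lemma nn_integral_st_dens:
  assumes "\<gamma> \<in> Params M" "(x, u) \<in> adm_pairs M"
  shows "(\<integral>\<^sup>+y. ennreal (st_dens M \<gamma> x u y) \<partial>st_base M) = 1"
proof -
  interpret prob_space "transition_law M \<gamma> x u" by (rule transition_law_prob) fact+
  note [measurable] = st_dens_section[OF assms]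
  have "(\<integral>\<^sup>+y. ennreal (st_dens M \<gamma> x u y) \<partial>st_base M)
      = emeasure (transition_law M \<gamma> x u) (space (st_base M))"
    using sets.top[of "st_base M"] unfolding transition_law_def by (subst emeasure_density) (auto intro!: nn_integral_cong)
  then show ?thesis
    using emeasure_space_1 by (simp add: transition_law_def)
qed

lemma rew_dens_lower_bound:
  assumes "\<gamma> \<in> Params M"
  obtains c where "0 < c" "\<And>x u r. (x, u) \<in> adm_pairs M \<Longrightarrow> r \<in> Rewards M \<Longrightarrow> c \<le> rew_dens M \<gamma> x u r"
proof
  let ?c = "INF ((x, u), r)\<in>adm_pairs M \<times> Rewards M. rew_dens M \<gamma> x u r"
  show "0 < ?c" using ident assms unfolding identifiability_assumption_def by blast
  fix x u r assume *: "(x, u) \<in> adm_pairs M" "r \<in> Rewards M"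
  \<comment> \<open>For reals, \<open>INF\<close> is a lower bound of the family only if the family
    is bounded below; here 0 bounds it.\<close>
  have "bdd_below ((\<lambda>((x, u), r). rew_dens M \<gamma> x u r) ` (adm_pairs M \<times> Rewards M))"
    by (rule bdd_belowI[where m = 0]) (auto intro: rew_dens_nonneg assms)
  from cINF_lower[OF this, of "((x, u), r)"] * show "?c \<le> rew_dens M \<gamma> x u r" by simp
qed

lemma st_dens_lower_bound:
  assumes "\<gamma> \<in> Params M"
  obtains c where "0 < c" "\<And>x u y. (x, u) \<in> adm_pairs M \<Longrightarrow> y \<in> States M \<Longrightarrow> c \<le> st_dens M \<gamma> x u y"
proof
  let ?c = "INF ((x, u), y)\<in>adm_pairs M \<times> States M. st_dens M \<gamma> x u y"
  show "0 < ?c" using ident assms unfolding identifiability_assumption_def by blast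
  fix x u y assume *: "(x, u) \<in> adm_pairs M" "y \<in> States M"
  have "bdd_below ((\<lambda>((x, u), y). st_dens M \<gamma> x u y) ` (adm_pairs M \<times> States M))"
    by (rule bdd_belowI[where m = 0]) (auto intro: st_dens_nonneg assms)
  from cINF_lower[OF this, of "((x, u), y)"] * show "?c \<le> st_dens M \<gamma> x u y" by simp
qed

definition joint_dens :: "'p \<Rightarrow> 'x \<times> 'u \<Rightarrow> real \<times> 'x \<Rightarrow> real" where
  "joint_dens \<gamma> z w =
    rew_dens M \<gamma> (fst z) (snd z) (fst w) * st_dens M \<gamma> (fst z) (snd z) (snd w)"

lemma joint_dens_compose:
  assumes "\<gamma> \<in> Params M" "f \<in> N \<rightarrow>\<^sub>M adm_space" "g \<in> N \<rightarrow>\<^sub>M reward_space M \<Otimes>\<^sub>M state_space M"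
  shows "(\<lambda>n. joint_dens \<gamma> (f n) (g n)) \<in> borel_measurable N"
proof -
  note [measurable] =
    rew_dens_compose[OF assms(1,2) measurable_compose[OF assms(3) measurable_fst]]
    st_dens_compose[OF assms(1,2) measurable_compose[OF assms(3) measurable_snd]]
  show ?thesis unfolding joint_dens_def by measurable
qed

lemma joint_dens_section:
  assumes "\<gamma> \<in> Params M" "z \<in> adm_pairs M"
  shows "joint_dens \<gamma> z \<in> borel_measurable (reward_space M \<Otimes>\<^sub>M state_space M)"
  using joint_dens_compose[OF assms(1) adm_space_const[OF assms(2)] measurable_ident] by simp

lemma space_base [simp]: "space base = Rewards M \<times> States M"
  by (simp add: space_pair_measure)

lemma sets_base: "sets base = sets (reward_space M \<Otimes>\<^sub>M state_space M)"
  by (intro sets_pair_measure_cong sets_rew_base sets_st_base)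

lemma joint_dens_lower_bound:
  assumes "\<gamma> \<in> Params M"
  obtains c where "0 < c" "\<And>z w. z \<in> adm_pairs M \<Longrightarrow> w \<in> space base \<Longrightarrow> c \<le> joint_dens \<gamma> z w"
proof -
  obtain c where c: "0 < c" "\<And>x u r. (x, u) \<in> adm_pairs M \<Longrightarrow> r \<in> Rewards M \<Longrightarrow> c \<le> rew_dens M \<gamma> x u r"
    using rew_dens_lower_bound[OF assms] by blast
  obtain d where d: "0 < d" "\<And>x u y. (x, u) \<in> adm_pairs M \<Longrightarrow> y \<in> States M \<Longrightarrow> d \<le> st_dens M \<gamma> x u y"
    using st_dens_lower_bound[OF assms] by blast
  have "c * d \<le> joint_dens \<gamma> z w" if "z \<in> adm_pairs M" "w \<in> space base" for z w
    using c(2)[of "fst z" "snd z" "fst w"] d(2)[of "fst z" "snd z" "snd w"] that c(1) d(1)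
    unfolding joint_dens_def by (intro mult_mono) auto
  moreover have "0 < c * d" using c d by simp
  ultimately show thesis using that by blast
qed

lemma joint_dens_pos:
  assumes "\<gamma> \<in> Params M" "z \<in> adm_pairs M" "w \<in> space base"
  shows "0 < joint_dens \<gamma> z w"
proof -
  obtain c where c: "0 < c" "\<And>z w. z \<in> adm_pairs M \<Longrightarrow> w \<in> space base \<Longrightarrow> c \<le> joint_dens \<gamma> z w"
    using joint_dens_lower_bound[OF assms(1)] by blast
  show ?thesis using c(1) c(2)[OF assms(2,3)] by linarith
qed

sublocale rb: sigma_finite_measure "rew_base M" by (rule sigma_finite_rew_base)
sublocale sb: sigma_finite_measure "st_base M" by (rule sigma_finite_st_base)
sublocale rsb: pair_sigma_finite "rew_base M" "st_base M" ..

lemma nn_integral_joint_dens: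
  assumes "\<gamma> \<in> Params M" "z \<in> adm_pairs M"
  shows "(\<integral>\<^sup>+w. ennreal (joint_dens \<gamma> z w) \<partial>base) = 1"
proof -
  obtain x u where z: "z = (x, u)" by fastforce
  note [measurable] = rew_dens_section[OF assms[unfolded z]] st_dens_section[OF assms[unfolded z]]
  have "(\<integral>\<^sup>+w. ennreal (joint_dens \<gamma> z w) \<partial>base)
      = (\<integral>\<^sup>+r. \<integral>\<^sup>+y. ennreal (rew_dens M \<gamma> x u r) * ennreal (st_dens M \<gamma> x u y) \<partial>st_base M \<partial>rew_base M)"
    using assms unfolding joint_dens_def z
    by (subst sb.nn_integral_fst[symmetric])
      (auto intro!: nn_integral_cong simp: ennreal_mult rew_dens_nonneg st_dens_nonneg)
  also have "\<dots> = 1"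
    using assms unfolding z by (simp add: nn_integral_cmult nn_integral_st_dens nn_integral_rew_dens)
  finally show ?thesis .
qed

text \<open>The Bhattacharyya coefficient. It equals the mean of the root of the density ratio
  \<open>\<gamma>\<close> against \<open>\<theta>\<close> under \<open>\<theta>\<close>. With values
  in \<open>ennreal\<close>, it needs no prior proof of finiteness.\<close>

definition affinity :: "'p \<Rightarrow> 'x \<times> 'u \<Rightarrow> ennreal" where
  "affinity \<gamma> z = (\<integral>\<^sup>+w. ennreal (sqrt (joint_dens \<theta> z w * joint_dens \<gamma> z w)) \<partial>base)"

text \<open>The pointwise identity sqrt(ab) + (sqrt a - sqrt b)^2 / 2 = (a + b) / 2, integrated for
  two densities of total mass one. Keeping the squared Hellinger deficit, instead of stating an
  inequality, makes the equality case accessible.\<close>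

lemma AM_GM_joint_dens:
  assumes "\<gamma> \<in> Params M" "z \<in> adm_pairs M"
  shows "affinity \<gamma> z + (\<integral>\<^sup>+w. ennreal ((sqrt (joint_dens \<theta> z w) - sqrt (joint_dens \<gamma> z w))\<^sup>2 / 2) \<partial>base) = 1"
proof -
  note [measurable] = joint_dens_section[OF assms] joint_dens_section[OF \<theta> assms(2)]
  have pos: "0 < joint_dens \<theta> z w" "0 < joint_dens \<gamma> z w" if "w \<in> space base" for w
    using joint_dens_pos assms that by auto
  have "affinity \<gamma> z + (\<integral>\<^sup>+w. ennreal ((sqrt (joint_dens \<theta> z w) - sqrt (joint_dens \<gamma> z w))\<^sup>2 / 2) \<partial>base)
     = (\<integral>\<^sup>+w. ennreal (sqrt (joint_dens \<theta> z w * joint_dens \<gamma> z w))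
          + ennreal ((sqrt (joint_dens \<theta> z w) - sqrt (joint_dens \<gamma> z w))\<^sup>2 / 2) \<partial>base)"
    unfolding affinity_def by (rule nn_integral_add[symmetric]) measurable
  also have "\<dots> = (\<integral>\<^sup>+w. ennreal (1 / 2) * ennreal (joint_dens \<theta> z w) + ennreal (1 / 2) * ennreal (joint_dens \<gamma> z w) \<partial>base)"
  proof (rule nn_integral_cong)
    fix w assume "w \<in> space base"
    note p = pos[OF this]
    have "sqrt (joint_dens \<theta> z w * joint_dens \<gamma> z w) + (sqrt (joint_dens \<theta> z w) - sqrt (joint_dens \<gamma> z w))\<^sup>2 / 2
      = 1 / 2 * joint_dens \<theta> z w + 1 / 2 * joint_dens \<gamma> z w"
      using p by (simp add: power2_diff real_sqrt_mult field_simps)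
    moreover have "ennreal (sqrt (joint_dens \<theta> z w * joint_dens \<gamma> z w))
          + ennreal ((sqrt (joint_dens \<theta> z w) - sqrt (joint_dens \<gamma> z w))\<^sup>2 / 2)
       = ennreal (sqrt (joint_dens \<theta> z w * joint_dens \<gamma> z w)
          + (sqrt (joint_dens \<theta> z w) - sqrt (joint_dens \<gamma> z w))\<^sup>2 / 2)"
      using p by (intro ennreal_plus[symmetric]) auto
    moreover have "ennreal (1 / 2) * ennreal (joint_dens \<theta> z w) + ennreal (1 / 2) * ennreal (joint_dens \<gamma> z w)
      = ennreal (1 / 2 * joint_dens \<theta> z w + 1 / 2 * joint_dens \<gamma> z w)"
      using p by (simp only: ennreal_mult[symmetric] ennreal_plus[symmetric] mult_nonneg_nonneg less_imp_le)
    ultimately show "ennreal (sqrt (joint_dens \<theta> z w * joint_dens \<gamma> z w))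
          + ennreal ((sqrt (joint_dens \<theta> z w) - sqrt (joint_dens \<gamma> z w))\<^sup>2 / 2)
      = ennreal (1 / 2) * ennreal (joint_dens \<theta> z w) + ennreal (1 / 2) * ennreal (joint_dens \<gamma> z w)"
      by simp
  qed
  also have "\<dots> = ennreal (1 / 2) + ennreal (1 / 2)"
    by (subst nn_integral_add, measurable)
      (simp add: nn_integral_cmult nn_integral_joint_dens assms)
  also have "\<dots> = 1" by (subst ennreal_plus[symmetric]) auto
  finally show ?thesis .
qed

lemma affinity_le_1: "\<gamma> \<in> Params M \<Longrightarrow> z \<in> adm_pairs M \<Longrightarrow> affinity \<gamma> z \<le> 1"
  unfolding le_iff_add by (intro exI, rule sym, rule AM_GM_joint_dens)

text \<open>Affinity one forces the Hellinger deficit to vanish, so the densities agree almost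
  everywhere and the joint laws coincide. Their relative entropy is then zero, against the positive
  infimum.\<close>

lemma affinity_less_1:
  assumes "\<gamma> \<in> Params M" "\<gamma> \<noteq> \<theta>" "z \<in> adm_pairs M"
  shows "affinity \<gamma> z < 1"
proof (rule ccontr)
  obtain x u where z: "z = (x, u)" by fastforce
  note [measurable] = joint_dens_section[OF assms(1,3)] joint_dens_section[OF \<theta> assms(3)]
  have jl: "joint_law M \<gamma>' x u = density base (\<lambda>w. ennreal (joint_dens \<gamma>' z w))" for \<gamma>'
    by (simp add: joint_law_def joint_dens_def z split_beta')
  let ?I = "\<integral>\<^sup>+w. ennreal ((sqrt (joint_dens \<theta> z w) - sqrt (joint_dens \<gamma> z w))\<^sup>2 / 2) \<partial>base"
  assume "\<not> affinity \<gamma> z < 1"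
  then have "affinity \<gamma> z = 1" using affinity_le_1[OF assms(1,3)] by simp
  \<comment> \<open>Written as a sum on both sides to cancel in \<open>ennreal\<close>, which is
    legitimate because 1 is finite.\<close>
  then have "1 + ?I = 1 + 0"
    using AM_GM_joint_dens[OF assms(1,3)] by simp
  then have "?I = 0"
    unfolding ennreal_add_left_cancel by simp
  then have "AE w in base. ennreal ((sqrt (joint_dens \<theta> z w) - sqrt (joint_dens \<gamma> z w))\<^sup>2 / 2) = 0"
    by (subst (asm) nn_integral_0_iff_AE) measurable
  then have "AE w in base. joint_dens \<theta> z w = joint_dens \<gamma> z w"
    by eventually_elim (simp add: ennreal_eq_0_iff)
  then have eq: "joint_law M \<theta> x u = joint_law M \<gamma> x u"
    unfolding jl by (intro density_cong) auto
  \<comment> \<open>Supplies the sigma-finiteness required by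
    \<open>relative_entropy_self\<close>.\<close>
  have "prob_space (joint_law M \<gamma> x u)"
  proof
    have "emeasure (joint_law M \<gamma> x u) (space base) = (\<integral>\<^sup>+w. ennreal (joint_dens \<gamma> z w) \<partial>base)"
      unfolding jl using sets.top[of base]
      by (subst emeasure_density) (auto intro!: nn_integral_cong)
    then show "emeasure (joint_law M \<gamma> x u) (space (joint_law M \<gamma> x u)) = 1"
      using nn_integral_joint_dens[OF assms(1,3)] by (simp add: jl)
  qed
  then interpret J: prob_space "joint_law M \<gamma> x u" .
  have "relative_entropy (joint_law M \<theta> x u) (joint_law M \<gamma> x u) = 0"
    unfolding eq by (rule relative_entropy_self) (rule J.sigma_finite_measure_axioms)
  moreover have "0 < (INF (x, u)\<in>adm_pairs M. relative_entropy (joint_law M \<theta> x u) (joint_law M \<gamma> x u))"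
    using ident assms(1,2) by (simp add: identifiability_assumption_def)
  moreover have "(INF (x, u)\<in>adm_pairs M. relative_entropy (joint_law M \<theta> x u) (joint_law M \<gamma> x u))
      \<le> relative_entropy (joint_law M \<theta> x u) (joint_law M \<gamma> x u)"
    by (rule INF_lower2[OF assms(3)]) (simp add: z)
  ultimately show False by simp
qed

section \<open>The filtration and the one-step law\<close>

lemma
  shows prob_space_P: "prob_space P"
    and sets_P: "sets P = sets (ts_space M)"
    and initial_state: "AE \<omega> in P. tX 0 \<omega> = x0"
    and cond_law_param: "cond_law P (ts_hist_space M t) (tH t) (count_space (Params M)) (tTheta t)
      (\<lambda>\<omega>. point_measure (Params M) (\<lambda>\<gamma>. ennreal (posterior M \<pi>0 t \<omega> \<gamma>)))"
    and control_eq: "AE \<omega> in P. tU t \<omega> = \<mu> (tTheta t \<omega>) (tX t \<omega>)"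
    and cond_law_reward:
      "cond_law P (ts_hist_space M t \<Otimes>\<^sub>M count_space (Params M) \<Otimes>\<^sub>M control_space M)
       (\<lambda>\<omega>. (tH t \<omega>, tTheta t \<omega>, tU t \<omega>))
       (reward_space M) (tR t) (\<lambda>\<omega>. reward_law M \<theta> (tX t \<omega>) (tU t \<omega>))"
    and cond_law_state: "cond_law P
       (ts_hist_space M t \<Otimes>\<^sub>M count_space (Params M) \<Otimes>\<^sub>M control_space M \<Otimes>\<^sub>M reward_space M)
       (\<lambda>\<omega>. (tH t \<omega>, tTheta t \<omega>, tU t \<omega>, tR t \<omega>))
       (state_space M) (tX (Suc t)) (\<lambda>\<omega>. transition_law M \<theta> (tX t \<omega>) (tU t \<omega>))"
  using law unfolding thompson_law_def by blast+

sublocale P: prob_space P by (rule prob_space_P)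

text \<open>\<open>FH\<close>, \<open>FU\<close> and \<open>FR\<close> are the information before
  the parameter is drawn, after the control is chosen, and after the reward is seen. They are
  generated by exactly the conditioning variables of \<open>thompson_law\<close>, so that its
  conditional laws apply verbatim.\<close>

definition FH :: "nat \<Rightarrow> ('x, 'u, 'p) ts_traj measure" where
  "FH t = sigma_gen P (ts_hist_space M t) (tH t)"

definition FU :: "nat \<Rightarrow> ('x, 'u, 'p) ts_traj measure" where
  "FU t = sigma_gen P (ts_hist_space M t \<Otimes>\<^sub>M count_space (Params M) \<Otimes>\<^sub>M control_space M)
     (\<lambda>\<omega>. (tH t \<omega>, tTheta t \<omega>, tU t \<omega>))"

definition FR :: "nat \<Rightarrow> ('x, 'u, 'p) ts_traj measure" where
  "FR t = sigma_gen P
     (ts_hist_space M t \<Otimes>\<^sub>M count_space (Params M) \<Otimes>\<^sub>M control_space M \<Otimes>\<^sub>M reward_space M)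
     (\<lambda>\<omega>. (tH t \<omega>, tTheta t \<omega>, tU t \<omega>, tR t \<omega>))"

section \<open>Measurability of the coordinates and inclusions between the sigma-algebras\<close>

lemma space_FH [simp]: "space (FH t) = space P"
  and space_FU [simp]: "space (FU t) = space P"
  and space_FR [simp]: "space (FR t) = space P"
  by (simp_all add: FH_def FU_def FR_def)

lemma coordinates_of_step:
  assumes "(\<lambda>\<omega>. \<omega> s) \<in> G \<rightarrow>\<^sub>M ts_step_space M"
  shows "tX s \<in> G \<rightarrow>\<^sub>M state_space M" "tTheta s \<in> G \<rightarrow>\<^sub>M count_space (Params M)"
    "tU s \<in> G \<rightarrow>\<^sub>M control_space M" "tR s \<in> G \<rightarrow>\<^sub>M reward_space M"
  using assms unfolding tX_def[abs_def] tTheta_def[abs_def] tU_def[abs_def] tR_def[abs_def] ts_step_space_def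
  by (auto intro: measurable_compose measurable_fst measurable_snd)

lemma step_P: "(\<lambda>\<omega>. \<omega> s) \<in> P \<rightarrow>\<^sub>M ts_step_space M"
proof -
  have "(\<lambda>\<omega>. \<omega> s) \<in> ts_space M \<rightarrow>\<^sub>M ts_step_space M"
    unfolding ts_space_def by (rule measurable_component_singleton) simp
  then show ?thesis by (simp cong: measurable_cong_sets add: sets_P)
qed

lemmas coordinates_P [measurable] = coordinates_of_step[OF step_P]

lemma measurable_tH:
  assumes "\<And>s. s < t \<Longrightarrow> (\<lambda>\<omega>. \<omega> s) \<in> G \<rightarrow>\<^sub>M ts_step_space M" "tX t \<in> G \<rightarrow>\<^sub>M state_space M"
  shows "tH t \<in> G \<rightarrow>\<^sub>M ts_hist_space M t"
  unfolding tH_def[abs_def] ts_hist_space_def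
  by (intro measurable_Pair measurable_restrict assms) simp

lemma tH_P [measurable]: "tH t \<in> P \<rightarrow>\<^sub>M ts_hist_space M t"
  by (intro measurable_tH step_P coordinates_P)

lemma subalgebra_FH: "subalgebra P (FH t)"
  and subalgebra_FU: "subalgebra P (FU t)"
  and subalgebra_FR: "subalgebra P (FR t)"
  unfolding FH_def FU_def FR_def by (intro subalgebra_sigma_gen; measurable)+

lemma hist_step: "s < t \<Longrightarrow> (\<lambda>h. fst h s) \<in> ts_hist_space M t \<rightarrow>\<^sub>M ts_step_space M"
  unfolding ts_hist_space_def
  by (rule measurable_compose[OF measurable_fst measurable_component_singleton]) simp

lemma hist_state: "snd \<in> ts_hist_space M t \<rightarrow>\<^sub>M state_space M"
  unfolding ts_hist_space_def by (rule measurable_snd)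

lemma FU_step:
  assumes "s < t"
  shows "(\<lambda>\<omega>. \<omega> s) \<in> FU t \<rightarrow>\<^sub>M ts_step_space M"
proof -
  have "(\<lambda>\<omega>. fst (fst (tH t \<omega>, tTheta t \<omega>, tU t \<omega>)) s) \<in> FU t \<rightarrow>\<^sub>M ts_step_space M"
    unfolding FU_def
    by (rule measurable_sigma_gen[OF _ measurable_compose[OF measurable_fst hist_step[OF assms]]])
      measurable
  then show ?thesis using assms by (simp add: tH_def)
qed

lemma FR_step:
  assumes "s < t"
  shows "(\<lambda>\<omega>. \<omega> s) \<in> FR t \<rightarrow>\<^sub>M ts_step_space M"
proof -
  have "(\<lambda>\<omega>. fst (fst (tH t \<omega>, tTheta t \<omega>, tU t \<omega>, tR t \<omega>)) s) \<in> FR t \<rightarrow>\<^sub>M ts_step_space M"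
    unfolding FR_def
    by (rule measurable_sigma_gen[OF _ measurable_compose[OF measurable_fst hist_step[OF assms]]])
      measurable
  then show ?thesis using assms by (simp add: tH_def)
qed

lemma FU_current:
  shows "tX t \<in> FU t \<rightarrow>\<^sub>M state_space M" "tTheta t \<in> FU t \<rightarrow>\<^sub>M count_space (Params M)"
    "tU t \<in> FU t \<rightarrow>\<^sub>M control_space M"
proof -
  let ?N = "ts_hist_space M t \<Otimes>\<^sub>M count_space (Params M) \<Otimes>\<^sub>M control_space M"
  have m: "(\<lambda>\<omega>. (tH t \<omega>, tTheta t \<omega>, tU t \<omega>)) \<in> P \<rightarrow>\<^sub>M ?N" by measurable
  have "(\<lambda>v. snd (fst v)) \<in> ?N \<rightarrow>\<^sub>M state_space M"
    by (rule measurable_compose[OF measurable_fst hist_state])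
  then have "(\<lambda>\<omega>. snd (fst (tH t \<omega>, tTheta t \<omega>, tU t \<omega>))) \<in> FU t \<rightarrow>\<^sub>M state_space M"
    unfolding FU_def by (rule measurable_sigma_gen[OF m])
  then show "tX t \<in> FU t \<rightarrow>\<^sub>M state_space M"
    by (simp add: tH_def)
  have "(\<lambda>v. fst (snd v)) \<in> ?N \<rightarrow>\<^sub>M count_space (Params M)" by measurable
  from measurable_sigma_gen[OF m this] show "tTheta t \<in> FU t \<rightarrow>\<^sub>M count_space (Params M)"
    by (simp add: FU_def)
  have "(\<lambda>v. snd (snd v)) \<in> ?N \<rightarrow>\<^sub>M control_space M" by measurable
  from measurable_sigma_gen[OF m this] show "tU t \<in> FU t \<rightarrow>\<^sub>M control_space M"
    by (simp add: FU_def)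
qed

lemma FR_current:
  shows "tX t \<in> FR t \<rightarrow>\<^sub>M state_space M" "tTheta t \<in> FR t \<rightarrow>\<^sub>M count_space (Params M)"
    "tU t \<in> FR t \<rightarrow>\<^sub>M control_space M" "tR t \<in> FR t \<rightarrow>\<^sub>M reward_space M"
proof -
  let ?N = "ts_hist_space M t \<Otimes>\<^sub>M count_space (Params M) \<Otimes>\<^sub>M control_space M \<Otimes>\<^sub>M reward_space M"
  have m: "(\<lambda>\<omega>. (tH t \<omega>, tTheta t \<omega>, tU t \<omega>, tR t \<omega>)) \<in> P \<rightarrow>\<^sub>M ?N" by measurable
  have "(\<lambda>v. snd (fst v)) \<in> ?N \<rightarrow>\<^sub>M state_space M"
    by (rule measurable_compose[OF measurable_fst hist_state])
  then have "(\<lambda>\<omega>. snd (fst (tH t \<omega>, tTheta t \<omega>, tU t \<omega>, tR t \<omega>))) \<in> FR t \<rightarrow>\<^sub>M state_space M"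
    unfolding FR_def by (rule measurable_sigma_gen[OF m])
  then show "tX t \<in> FR t \<rightarrow>\<^sub>M state_space M"
    by (simp add: tH_def)
  have "(\<lambda>v. fst (snd v)) \<in> ?N \<rightarrow>\<^sub>M count_space (Params M)" by measurable
  from measurable_sigma_gen[OF m this] show "tTheta t \<in> FR t \<rightarrow>\<^sub>M count_space (Params M)"
    by (simp add: FR_def)
  have "(\<lambda>v. fst (snd (snd v))) \<in> ?N \<rightarrow>\<^sub>M control_space M" by measurable
  from measurable_sigma_gen[OF m this] show "tU t \<in> FR t \<rightarrow>\<^sub>M control_space M"
    by (simp add: FR_def)
  have "(\<lambda>v. snd (snd (snd v))) \<in> ?N \<rightarrow>\<^sub>M reward_space M" by measurable
  from measurable_sigma_gen[OF m this] show "tR t \<in> FR t \<rightarrow>\<^sub>M reward_space M"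
    by (simp add: FR_def)
qed

lemma FU_state: "s \<le> t \<Longrightarrow> tX s \<in> FU t \<rightarrow>\<^sub>M state_space M"
  using FU_current coordinates_of_step[OF FU_step] by (cases "s = t") auto

text \<open>Allows a test function fixed at time \<open>n\<close> to be used against every later
  step; in \<open>residual_regret_L1\<close> it is the sign of the regret.\<close>

lemma FH_subset_FU: "n \<le> t \<Longrightarrow> sets (FH n) \<subseteq> sets (FU t)"
  unfolding FH_def by (intro sets_sigma_gen_subset measurable_tH FU_step FU_state) auto

lemma FU_subset_FR: "sets (FU t) \<subseteq> sets (FR t)"
  unfolding FU_def
  by (intro sets_sigma_gen_subset measurable_Pair measurable_tH FR_step FR_current) auto

lemma policy:
  assumes "\<gamma> \<in> Params M"
  shows "\<mu> \<gamma> \<in> state_space M \<rightarrow>\<^sub>M control_space M"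
    and "\<And>x. x \<in> States M \<Longrightarrow> \<mu> \<gamma> x \<in> Adm M x"
    and "\<And>x. x \<in> States M \<Longrightarrow> \<nu> \<gamma> x = bellman_rhs M \<gamma> (\<nu> \<gamma>) x (\<mu> \<gamma> x)"
    and "bellman_solution M \<gamma> (\<nu> \<gamma>)"
  using opt assms unfolding optimality_assumption_def by blast+

text \<open>The recommended control agrees almost surely with the control \<^term>\<open>tU t\<close>, but it is
  admissible at every sample point, so that the densities can be evaluated there.\<close>

definition XU :: "nat \<Rightarrow> ('x, 'u, 'p) ts_traj \<Rightarrow> 'x \<times> 'u" where
  "XU t \<omega> = (tX t \<omega>, \<mu> (tTheta t \<omega>) (tX t \<omega>))"

lemma tX_States [simp]: "\<omega> \<in> space P \<Longrightarrow> tX t \<omega> \<in> States M"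
  using measurable_space[OF coordinates_P(1)] by simp

lemma tTheta_Params [simp]: "\<omega> \<in> space P \<Longrightarrow> tTheta t \<omega> \<in> Params M"
  using measurable_space[OF coordinates_P(2)] by simp

lemma tR_Rewards [simp]: "\<omega> \<in> space P \<Longrightarrow> tR t \<omega> \<in> Rewards M"
  using measurable_space[OF coordinates_P(4)] by simp

lemma XU_adm [simp]: "\<omega> \<in> space P \<Longrightarrow> XU t \<omega> \<in> adm_pairs M"
  by (auto simp: XU_def adm_pairs_def intro: policy)

lemma XU_eq: "AE \<omega> in P. XU t \<omega> = (tX t \<omega>, tU t \<omega>)"
  using control_eq[of t] by eventually_elim (simp add: XU_def)

lemma selected_pair_measurable:
  assumes "\<gamma> \<in> Params M"
  shows "(\<lambda>x. (x, \<mu> \<gamma> x)) \<in> state_space M \<rightarrow>\<^sub>M adm_space"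
  by (rule measurable_restrict_space2)
    (auto intro!: measurable_Pair measurable_ident_sets policy assms simp: adm_pairs_def)

text \<open>Each policy is measurable for a fixed parameter; since the drawn parameter takes
  finitely many values, the sections can be glued along the random choice.\<close>

lemma XU_FU: "XU t \<in> FU t \<rightarrow>\<^sub>M adm_space"
proof -
  have "(\<lambda>\<omega>. (\<lambda>\<gamma> \<omega>. (tX t \<omega>, \<mu> \<gamma> (tX t \<omega>))) (tTheta t \<omega>) \<omega>) \<in> FU t \<rightarrow>\<^sub>M adm_space"
    by (rule measurable_compose_countable'[OF _ FU_current(2)])
      (auto intro: measurable_compose[OF FU_current(1) selected_pair_measurable]
        countable_finite Params_finite)
  then show ?thesis by (simp add: XU_def[abs_def])
qed

lemma XU_FR: "XU t \<in> FR t \<rightarrow>\<^sub>M adm_space"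
  by (rule measurable_subset_sets[OF FU_subset_FR _ XU_FU]) simp

text \<open>The conditional law is given at the played pair. Replacing it by \<open>XU\<close>
  alters it only on a null set, but yields a kernel that is measurable and a probability at every
  sample point, as \<open>disintegration\<close> demands. The same holds for
  \<open>state_disintegration\<close>, with \<open>FR\<close> in place of \<open>FU\<close>.\<close>

lemma reward_disintegration:
  "distr P (FU t \<Otimes>\<^sub>M reward_space M) (\<lambda>\<omega>. (\<omega>, tR t \<omega>))
    = density (restr_to_subalg P (FU t) \<Otimes>\<^sub>M rew_base M)
        (\<lambda>(\<omega>, r). ennreal (rew_dens M \<theta> (fst (XU t \<omega>)) (snd (XU t \<omega>)) r))"
proof (rule disintegration[OF prob_space_P subalgebra_FU _ sigma_finite_rew_base sets_rew_base])
  show "(\<lambda>(\<omega>, r). ennreal (rew_dens M \<theta> (fst (XU t \<omega>)) (snd (XU t \<omega>)) r))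
      \<in> borel_measurable (FU t \<Otimes>\<^sub>M rew_base M)"
    unfolding split_beta'
    by (intro measurable_compose[OF rew_dens_compose measurable_ennreal]
        measurable_compose[OF measurable_fst XU_FU] \<theta>)
      (simp add: sets_rew_base cong: measurable_cong_sets)
  show "prob_space (density (rew_base M)
      (\<lambda>r. case (\<omega>, r) of (\<omega>, r) \<Rightarrow> ennreal (rew_dens M \<theta> (fst (XU t \<omega>)) (snd (XU t \<omega>)) r)))"
    if "\<omega> \<in> space P" for \<omega>
    using reward_law_prob[OF \<theta>, of "fst (XU t \<omega>)" "snd (XU t \<omega>)"] that by (simp add: reward_law_def)
  fix A assume "A \<in> sets (reward_space M)"
  then have "AE \<omega> in P. real_cond_exp P (FU t) (indicator (tR t -` A \<inter> space P)) \<omega>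
      = measure (reward_law M \<theta> (tX t \<omega>) (tU t \<omega>)) A"
    using cond_law_reward[of t] by (simp add: cond_law_def FU_def)
  with XU_eq[of t] show "AE \<omega> in P. real_cond_exp P (FU t) (indicator (tR t -` A \<inter> space P)) \<omega>
      = measure (density (rew_base M)
          (\<lambda>r. case (\<omega>, r) of (\<omega>, r) \<Rightarrow> ennreal (rew_dens M \<theta> (fst (XU t \<omega>)) (snd (XU t \<omega>)) r))) A"
    by eventually_elim (simp add: reward_law_def)
qed measurable

lemma state_disintegration:
  "distr P (FR t \<Otimes>\<^sub>M state_space M) (\<lambda>\<omega>. (\<omega>, tX (Suc t) \<omega>))
    = density (restr_to_subalg P (FR t) \<Otimes>\<^sub>M st_base M)
        (\<lambda>(\<omega>, y). ennreal (st_dens M \<theta> (fst (XU t \<omega>)) (snd (XU t \<omega>)) y))"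
proof (rule disintegration[OF prob_space_P subalgebra_FR _ sigma_finite_st_base sets_st_base])
  show "(\<lambda>(\<omega>, y). ennreal (st_dens M \<theta> (fst (XU t \<omega>)) (snd (XU t \<omega>)) y))
      \<in> borel_measurable (FR t \<Otimes>\<^sub>M st_base M)"
    unfolding split_beta'
    by (intro measurable_compose[OF st_dens_compose measurable_ennreal]
        measurable_compose[OF measurable_fst XU_FR] \<theta>)
      (simp add: sets_st_base cong: measurable_cong_sets)
  show "prob_space (density (st_base M)
      (\<lambda>y. case (\<omega>, y) of (\<omega>, y) \<Rightarrow> ennreal (st_dens M \<theta> (fst (XU t \<omega>)) (snd (XU t \<omega>)) y)))"
    if "\<omega> \<in> space P" for \<omega>
    using transition_law_prob[OF \<theta>, of "fst (XU t \<omega>)" "snd (XU t \<omega>)"] that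
    by (simp add: transition_law_def)
  fix A assume "A \<in> sets (state_space M)"
  then have "AE \<omega> in P. real_cond_exp P (FR t) (indicator (tX (Suc t) -` A \<inter> space P)) \<omega>
      = measure (transition_law M \<theta> (tX t \<omega>) (tU t \<omega>)) A"
    using cond_law_state[of t] by (simp add: cond_law_def FR_def)
  with XU_eq[of t] show "AE \<omega> in P. real_cond_exp P (FR t) (indicator (tX (Suc t) -` A \<inter> space P)) \<omega>
      = measure (density (st_base M)
          (\<lambda>y. case (\<omega>, y) of (\<omega>, y) \<Rightarrow> ennreal (st_dens M \<theta> (fst (XU t \<omega>)) (snd (XU t \<omega>)) y))) A"
    by eventually_elim (simp add: transition_law_def)
qed measurable

text \<open>The next state is integrated out given \<open>FR\<close>, where the reward is known, and
  then the reward given \<open>FU\<close>. The transition density does not depend on the reward, so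
  by Tonelli the two integrations combine into one against the joint density.\<close>

lemma one_step_nn_integral:
  fixes g :: "_ \<Rightarrow> ennreal"
  assumes g [measurable]: "g \<in> borel_measurable (FU t \<Otimes>\<^sub>M (reward_space M \<Otimes>\<^sub>M state_space M))"
  shows "(\<integral>\<^sup>+\<omega>. g (\<omega>, tR t \<omega>, tX (Suc t) \<omega>) \<partial>P)
    = (\<integral>\<^sup>+\<omega>. (\<integral>\<^sup>+w. ennreal (joint_dens \<theta> (XU t \<omega>) w) * g (\<omega>, w) \<partial>base) \<partial>P)"
proof -
  define f where "f \<omega> r = ennreal (rew_dens M \<theta> (fst (XU t \<omega>)) (snd (XU t \<omega>)) r)" for \<omega> r
  define q where "q \<omega> y = ennreal (st_dens M \<theta> (fst (XU t \<omega>)) (snd (XU t \<omega>)) y)" for \<omega> y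
  have idU: "(\<lambda>\<omega>. \<omega>) \<in> FR t \<rightarrow>\<^sub>M FU t"
    by (rule measurable_subset_sets[OF FU_subset_FR]) simp_all
  have fm [measurable]: "(\<lambda>(\<omega>, r). f \<omega> r) \<in> borel_measurable (FU t \<Otimes>\<^sub>M reward_space M)"
    unfolding split_beta' f_def
    by (intro measurable_compose[OF rew_dens_compose measurable_ennreal]
        measurable_compose[OF measurable_fst XU_FU] \<theta>) measurable
  have qm [measurable]: "(\<lambda>(\<omega>, y). q \<omega> y) \<in> borel_measurable (FU t \<Otimes>\<^sub>M state_space M)"
    unfolding split_beta' q_def
    by (intro measurable_compose[OF st_dens_compose measurable_ennreal]
        measurable_compose[OF measurable_fst XU_FU] \<theta>) measurable
  note [measurable] = FR_current(4)[of t] measurable_compose[OF measurable_fst idU]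
  have qmR: "(\<lambda>(\<omega>, y). q \<omega> y) \<in> borel_measurable (FR t \<Otimes>\<^sub>M st_base M)"
    using measurable_compose[OF measurable_Pair[OF measurable_compose[OF measurable_fst idU] measurable_snd] qm]
    by (simp add: split_beta' sets_st_base cong: measurable_cong_sets)
  have fmB: "(\<lambda>(\<omega>, r). f \<omega> r) \<in> borel_measurable (FU t \<Otimes>\<^sub>M rew_base M)"
    using fm by (simp add: sets_rew_base cong: measurable_cong_sets sets_pair_measure_cong)
  have "(\<integral>\<^sup>+\<omega>. g (\<omega>, tR t \<omega>, tX (Suc t) \<omega>) \<partial>P)
      = (\<integral>\<^sup>+\<omega>. (\<integral>\<^sup>+y. q \<omega> y * g (\<omega>, tR t \<omega>, y) \<partial>st_base M) \<partial>P)"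
    using disintegration_nn_integral[OF prob_space_P subalgebra_FR _ sigma_finite_st_base sets_st_base
        qmR, of "tX (Suc t)" "\<lambda>(\<omega>, y). g (\<omega>, tR t \<omega>, y)"] state_disintegration[of t]
    unfolding q_def by simp
  also have "\<dots> = (\<integral>\<^sup>+\<omega>. (\<integral>\<^sup>+r. f \<omega> r * (\<integral>\<^sup>+y. q \<omega> y * g (\<omega>, r, y) \<partial>st_base M) \<partial>rew_base M) \<partial>P)"
    using disintegration_nn_integral[OF prob_space_P subalgebra_FU _ sigma_finite_rew_base sets_rew_base
        fmB, of "tR t" "\<lambda>(\<omega>, r). \<integral>\<^sup>+y. q \<omega> y * g (\<omega>, r, y) \<partial>st_base M"] reward_disintegration[of t]
    unfolding f_def by simp
  also have "\<dots> = (\<integral>\<^sup>+\<omega>. (\<integral>\<^sup>+w. ennreal (joint_dens \<theta> (XU t \<omega>) w) * g (\<omega>, w) \<partial>base) \<partial>P)"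
  proof (rule nn_integral_cong)
    fix \<omega> assume \<omega>: "\<omega> \<in> space P"
    have a: "(fst (XU t \<omega>), snd (XU t \<omega>)) \<in> adm_pairs M" using \<omega> by simp
    note [measurable] = joint_dens_section[OF \<theta> XU_adm[OF \<omega>]] st_dens_section[OF \<theta> a] rew_dens_section[OF \<theta> a]
      measurable_compose[OF measurable_Pair1'[of \<omega> "FU t"] g]
    show "(\<integral>\<^sup>+r. f \<omega> r * (\<integral>\<^sup>+y. q \<omega> y * g (\<omega>, r, y) \<partial>st_base M) \<partial>rew_base M)
       = (\<integral>\<^sup>+w. ennreal (joint_dens \<theta> (XU t \<omega>) w) * g (\<omega>, w) \<partial>base)"
      using \<omega> a unfolding q_def f_def joint_dens_def
      by (subst sb.nn_integral_fst[symmetric], measurable)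
        (auto intro!: nn_integral_cong simp: nn_integral_cmult[symmetric] ennreal_mult
          rew_dens_nonneg st_dens_nonneg mult.assoc)
  qed
  finally show ?thesis .
qed

section \<open>Consistency of the posterior\<close>

lemma FU_mono:
  assumes "n < t"
  shows "sets (FU n) \<subseteq> sets (FU t)"
  unfolding FU_def[of n] using assms
  by (intro sets_sigma_gen_subset measurable_Pair measurable_tH FU_step FU_state
      coordinates_of_step(2,3)[OF FU_step]) auto

text \<open>The square root of the likelihood ratio up to a null set. The likelihood itself is evaluated at
  the actual controls, where it need not be measurable.\<close>

primrec root_ratio :: "'p \<Rightarrow> nat \<Rightarrow> ('x, 'u, 'p) ts_traj \<Rightarrow> real" where
  "root_ratio \<gamma> 0 \<omega> = 1"
| "root_ratio \<gamma> (Suc t) \<omega> = root_ratio \<gamma> t \<omega> *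
    sqrt (joint_dens \<gamma> (XU t \<omega>) (tR t \<omega>, tX (Suc t) \<omega>) / joint_dens \<theta> (XU t \<omega>) (tR t \<omega>, tX (Suc t) \<omega>))"

lemma step_in_base [simp]: "\<omega> \<in> space P \<Longrightarrow> (tR t \<omega>, tX s \<omega>) \<in> space base"
  by simp

lemma root_ratio_nonneg: "\<gamma> \<in> Params M \<Longrightarrow> \<omega> \<in> space P \<Longrightarrow> 0 \<le> root_ratio \<gamma> t \<omega>"
  by (induction t) (simp_all add: joint_dens_pos less_imp_le del: space_base)

text \<open>The indices fit: the factor added at \<open>Suc t\<close> uses the reward at
  \<open>t\<close> and the state at \<open>Suc t\<close>, both already part of the history at
  \<open>Suc t\<close>.\<close>

lemma root_ratio_FU:
  assumes "\<gamma> \<in> Params M"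
  shows "root_ratio \<gamma> t \<in> borel_measurable (FU t)"
proof (induction t)
  case 0
  then show ?case by simp
next
  case (Suc t)
  have [measurable]: "root_ratio \<gamma> t \<in> borel_measurable (FU (Suc t))"
    by (rule measurable_subset_sets[OF FU_mono _ Suc.IH]) simp_all
  have XU': "XU t \<in> FU (Suc t) \<rightarrow>\<^sub>M adm_space"
    by (rule measurable_subset_sets[OF FU_mono _ XU_FU]) simp_all
  have w: "(\<lambda>\<omega>. (tR t \<omega>, tX (Suc t) \<omega>)) \<in> FU (Suc t) \<rightarrow>\<^sub>M reward_space M \<Otimes>\<^sub>M state_space M"
    by (intro measurable_Pair coordinates_of_step[OF FU_step] FU_current) simp
  note [measurable] = joint_dens_compose[OF assms XU' w] joint_dens_compose[OF \<theta> XU' w]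
  show ?case by (simp del: root_ratio.simps add: root_ratio.simps(2)[abs_def]) measurable
qed

text \<open>Countably many times leave one null set off which the played and recommended controls
  agree throughout. There the likelihood obeys the recursion that defines \<open>root_ratio\<close>,
  and the lower bounds make all its factors positive.\<close>

lemma root_ratio_eq:
  assumes "\<gamma> \<in> Params M"
  shows "AE \<omega> in P. \<forall>t. 0 < likelihood M \<gamma> t \<omega> \<and> 0 < likelihood M \<theta> t \<omega> \<and>
    root_ratio \<gamma> t \<omega> = sqrt (likelihood M \<gamma> t \<omega> / likelihood M \<theta> t \<omega>)"
proof -
  have "AE \<omega> in P. \<forall>t. XU t \<omega> = (tX t \<omega>, tU t \<omega>)"
    unfolding AE_all_countable using XU_eq by blast
  with AE_space show ?thesis
  proof eventually_elim
    case (elim \<omega>)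
    \<comment> \<open>The new factor has product index \<open>s = Suc t\<close>, hence is evaluated
      at the pair and reward of time \<open>s - 1 = t\<close>.\<close>
    have L: "likelihood M \<gamma>' (Suc t) \<omega>
        = likelihood M \<gamma>' t \<omega> * joint_dens \<gamma>' (XU t \<omega>) (tR t \<omega>, tX (Suc t) \<omega>)" for \<gamma>' t
      using elim(2) by (simp add: likelihood_def joint_dens_def)
    have pos: "0 < joint_dens \<gamma>' (XU t \<omega>) (tR t \<omega>, tX (Suc t) \<omega>)" if "\<gamma>' \<in> Params M" for \<gamma>' t
      using elim(1) that by (intro joint_dens_pos) simp_all
    have "0 < likelihood M \<gamma> t \<omega> \<and> 0 < likelihood M \<theta> t \<omega> \<and>
      root_ratio \<gamma> t \<omega> = sqrt (likelihood M \<gamma> t \<omega> / likelihood M \<theta> t \<omega>)" for t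
    proof (induction t)
      case 0
      show ?case by (simp add: likelihood_def)
    next
      case (Suc t)
      then show ?case
        using pos[OF assms, of t] pos[OF \<theta>, of t]
        by (simp add: L real_sqrt_mult[symmetric])
    qed
    then show ?case by blast
  qed
qed

text \<open>The cancellation p * sqrt(q / p) = sqrt(p * q), with p the true and q the rival joint
  density. The extra factor \<open>G\<close> carries a function of the next state through the step:
  \<open>G = 1\<close> gives the one-step mean, \<open>G = worst_affinity \<gamma>\<close> the
  two-step one.\<close>

lemma root_ratio_step:
  fixes G :: "'x \<Rightarrow> ennreal"
  assumes \<gamma>: "\<gamma> \<in> Params M" and G [measurable]: "G \<in> borel_measurable (state_space M)"
  shows "(\<integral>\<^sup>+\<omega>. ennreal (root_ratio \<gamma> (Suc t) \<omega>) * G (tX (Suc t) \<omega>) \<partial>P)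
    = (\<integral>\<^sup>+\<omega>. ennreal (root_ratio \<gamma> t \<omega>) *
        (\<integral>\<^sup>+w. ennreal (sqrt (joint_dens \<theta> (XU t \<omega>) w * joint_dens \<gamma> (XU t \<omega>) w)) * G (snd w) \<partial>base) \<partial>P)"
proof -
  let ?g = "\<lambda>(\<omega>, w). ennreal (root_ratio \<gamma> t \<omega>) *
     ennreal (sqrt (joint_dens \<gamma> (XU t \<omega>) w / joint_dens \<theta> (XU t \<omega>) w)) * G (snd w)"
  note [measurable] = measurable_compose[OF measurable_fst root_ratio_FU[OF \<gamma>]]
    joint_dens_compose[OF \<gamma> measurable_compose[OF measurable_fst XU_FU] measurable_snd]
    joint_dens_compose[OF \<theta> measurable_compose[OF measurable_fst XU_FU] measurable_snd]
  have g: "?g \<in> borel_measurable (FU t \<Otimes>\<^sub>M (reward_space M \<Otimes>\<^sub>M state_space M))"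
    unfolding split_beta' by measurable
  have "(\<integral>\<^sup>+\<omega>. ennreal (root_ratio \<gamma> (Suc t) \<omega>) * G (tX (Suc t) \<omega>) \<partial>P)
     = (\<integral>\<^sup>+\<omega>. ?g (\<omega>, tR t \<omega>, tX (Suc t) \<omega>) \<partial>P)"
    by (rule nn_integral_cong)
      (simp add: ennreal_mult root_ratio_nonneg[OF \<gamma>] joint_dens_pos[OF \<gamma>] joint_dens_pos[OF \<theta>] less_imp_le
        del: space_base)
  also have "\<dots> = (\<integral>\<^sup>+\<omega>. (\<integral>\<^sup>+w. ennreal (joint_dens \<theta> (XU t \<omega>) w) * ?g (\<omega>, w) \<partial>base) \<partial>P)"
    by (rule one_step_nn_integral[OF g])
  also have "\<dots> = (\<integral>\<^sup>+\<omega>. ennreal (root_ratio \<gamma> t \<omega>) *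
        (\<integral>\<^sup>+w. ennreal (sqrt (joint_dens \<theta> (XU t \<omega>) w * joint_dens \<gamma> (XU t \<omega>) w)) * G (snd w) \<partial>base) \<partial>P)"
  proof (rule nn_integral_cong)
    fix \<omega> assume \<omega>: "\<omega> \<in> space P"
    note [measurable] = joint_dens_section[OF \<theta> XU_adm[OF \<omega>]] joint_dens_section[OF \<gamma> XU_adm[OF \<omega>]]
    have "ennreal (joint_dens \<theta> (XU t \<omega>) w) * ?g (\<omega>, w)
      = ennreal (root_ratio \<gamma> t \<omega>) *
          (ennreal (sqrt (joint_dens \<theta> (XU t \<omega>) w * joint_dens \<gamma> (XU t \<omega>) w)) * G (snd w))"
      if w: "w \<in> space base" for w
    proof -
      have p: "0 < joint_dens \<theta> (XU t \<omega>) w" "0 < joint_dens \<gamma> (XU t \<omega>) w"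
        using joint_dens_pos[OF _ XU_adm[OF \<omega>] w] \<gamma> by auto
      then have "joint_dens \<theta> (XU t \<omega>) w * sqrt (joint_dens \<gamma> (XU t \<omega>) w / joint_dens \<theta> (XU t \<omega>) w)
        = sqrt (joint_dens \<theta> (XU t \<omega>) w * joint_dens \<gamma> (XU t \<omega>) w)"
        by (simp add: real_sqrt_divide real_sqrt_mult real_div_sqrt field_simps)
      then have "ennreal (joint_dens \<theta> (XU t \<omega>) w) * ennreal (sqrt (joint_dens \<gamma> (XU t \<omega>) w / joint_dens \<theta> (XU t \<omega>) w))
        = ennreal (sqrt (joint_dens \<theta> (XU t \<omega>) w * joint_dens \<gamma> (XU t \<omega>) w))"
        using p by (subst ennreal_mult[symmetric]) auto
      then show ?thesis by (simp add: mult_ac)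
    qed
    then have "(\<integral>\<^sup>+w. ennreal (joint_dens \<theta> (XU t \<omega>) w) * ?g (\<omega>, w) \<partial>base)
      = (\<integral>\<^sup>+w. ennreal (root_ratio \<gamma> t \<omega>) *
          (ennreal (sqrt (joint_dens \<theta> (XU t \<omega>) w * joint_dens \<gamma> (XU t \<omega>) w)) * G (snd w)) \<partial>base)"
      by (rule nn_integral_cong)
    then show "(\<integral>\<^sup>+w. ennreal (joint_dens \<theta> (XU t \<omega>) w) * ?g (\<omega>, w) \<partial>base)
      = ennreal (root_ratio \<gamma> t \<omega>) *
        (\<integral>\<^sup>+w. ennreal (sqrt (joint_dens \<theta> (XU t \<omega>) w * joint_dens \<gamma> (XU t \<omega>) w)) * G (snd w) \<partial>base)"
      by (simp only:) (rule nn_integral_cmult, measurable)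
  qed
  finally show ?thesis .
qed

text \<open>The control at \<open>y\<close> depends on the parameter drawn there. Maximizing over
  all parameters that could be drawn leaves a function of the state alone, and finiteness of
  \<open>Params M\<close> keeps it strictly below one.\<close>

definition worst_affinity :: "'p \<Rightarrow> 'x \<Rightarrow> ennreal" where
  "worst_affinity \<gamma> y = Max ((\<lambda>\<gamma>'. affinity \<gamma> (y, \<mu> \<gamma>' y)) ` Params M)"

lemma worst_affinity_measurable:
  assumes \<gamma>: "\<gamma> \<in> Params M"
  shows "worst_affinity \<gamma> \<in> borel_measurable (state_space M)"
proof -
  have "(\<lambda>y. affinity \<gamma> (y, \<mu> \<gamma>' y)) \<in> borel_measurable (state_space M)" if "\<gamma>' \<in> Params M" for \<gamma>'
  proof -
    note m = measurable_compose[OF measurable_fst[of "state_space M" base] selected_pair_measurable[OF that]]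
    have s: "snd \<in> state_space M \<Otimes>\<^sub>M base \<rightarrow>\<^sub>M reward_space M \<Otimes>\<^sub>M state_space M"
      using measurable_snd by (simp add: sets_base cong: measurable_cong_sets)
    note [measurable] = joint_dens_compose[OF \<gamma> m s] joint_dens_compose[OF \<theta> m s]
    show ?thesis unfolding affinity_def by measurable
  qed
  then show ?thesis
    unfolding worst_affinity_def[abs_def] by (intro borel_measurable_Max Params_finite) auto
qed

lemma worst_affinity_less_1:
  assumes "\<gamma> \<in> Params M" "\<gamma> \<noteq> \<theta>" "y \<in> States M"
  shows "worst_affinity \<gamma> y < 1"
proof -
  have "affinity \<gamma> (y, \<mu> \<gamma>' y) < 1" if "\<gamma>' \<in> Params M" for \<gamma>'
    using assms that by (intro affinity_less_1) (auto simp: adm_pairs_def policy)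
  moreover have "Params M \<noteq> {}" using \<theta> by blast
  ultimately show ?thesis
    unfolding worst_affinity_def by (subst Max_less_iff) (auto simp: Params_finite)
qed

lemma affinity_le_worst: "\<omega> \<in> space P \<Longrightarrow> affinity \<gamma> (XU t \<omega>) \<le> worst_affinity \<gamma> (tX t \<omega>)"
  unfolding XU_def worst_affinity_def by (rule Max_ge) (simp_all add: Params_finite)

text \<open>Let s be the root of the product of the densities, W the worst affinity at the next
  state. The integral of s * W plus that of s * (1 - W) is the affinity, at most one. Since s is at
  least sqrt(c * d) uniformly in \<open>z\<close>, the second integral is at least
  \<open>\<delta>\<close>, which no longer depends on \<open>z\<close>. The deficit is thus
  integrated over all next states, so no threshold for W has to be chosen.\<close>

lemma contraction:
  assumes \<gamma>: "\<gamma> \<in> Params M" "\<gamma> \<noteq> \<theta>"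
  obtains \<rho> where "\<rho> < 1" "\<And>z. z \<in> adm_pairs M \<Longrightarrow>
    (\<integral>\<^sup>+w. ennreal (sqrt (joint_dens \<theta> z w * joint_dens \<gamma> z w)) * worst_affinity \<gamma> (snd w) \<partial>base) \<le> \<rho>"
proof -
  obtain c where c: "0 < c" "\<And>z w. z \<in> adm_pairs M \<Longrightarrow> w \<in> space base \<Longrightarrow> c \<le> joint_dens \<theta> z w"
    using joint_dens_lower_bound[OF \<theta>] by blast
  obtain d where d: "0 < d" "\<And>z w. z \<in> adm_pairs M \<Longrightarrow> w \<in> space base \<Longrightarrow> d \<le> joint_dens \<gamma> z w"
    using joint_dens_lower_bound[OF \<gamma>(1)] by blast
  note [measurable] = worst_affinity_measurable[OF \<gamma>(1)]
  define J where "J = (\<integral>\<^sup>+w. 1 - worst_affinity \<gamma> (snd w) \<partial>base)"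
  have "J \<noteq> 0"
  proof
    assume "J = 0"
    then have "AE w in base. 1 - worst_affinity \<gamma> (snd w) = 0"
      unfolding J_def by (subst (asm) nn_integral_0_iff_AE) measurable
    then have "AE w in base. False"
      using AE_space
    proof eventually_elim
      case (elim w)
      then show ?case
        using worst_affinity_less_1[OF \<gamma>, of "snd w"] by (auto simp: diff_eq_0_iff_ennreal)
    qed
    \<comment> \<open>A property that fails everywhere holds almost everywhere only for the null
      measure, but \<open>base\<close> carries a density of mass one; the optimal pair at
      \<open>x0\<close> serves as a concrete admissible pair.\<close>
    then have "(\<integral>\<^sup>+w. ennreal (joint_dens \<theta> (x0, \<mu> \<theta> x0) w) \<partial>base) = (\<integral>\<^sup>+w. 0 \<partial>base)"
      by (intro nn_integral_cong_AE) auto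
    moreover have "(x0, \<mu> \<theta> x0) \<in> adm_pairs M"
      using x0 by (simp add: adm_pairs_def policy)
    ultimately show False by (simp add: nn_integral_joint_dens)
  qed
  define \<delta> where "\<delta> = ennreal (sqrt (c * d)) * J"
  have "\<delta> \<noteq> 0" using c d \<open>J \<noteq> 0\<close> by (simp add: \<delta>_def)
  have bound: "(\<integral>\<^sup>+w. ennreal (sqrt (joint_dens \<theta> z w * joint_dens \<gamma> z w)) * worst_affinity \<gamma> (snd w) \<partial>base) + \<delta> \<le> 1"
    if z: "z \<in> adm_pairs M" for z
  proof -
    note [measurable] = joint_dens_section[OF \<theta> z] joint_dens_section[OF \<gamma>(1) z]
    let ?s = "\<lambda>w. ennreal (sqrt (joint_dens \<theta> z w * joint_dens \<gamma> z w))"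
    have "\<delta> = (\<integral>\<^sup>+w. ennreal (sqrt (c * d)) * (1 - worst_affinity \<gamma> (snd w)) \<partial>base)"
      unfolding \<delta>_def J_def by (rule nn_integral_cmult[symmetric]) measurable
    also have "\<dots> \<le> (\<integral>\<^sup>+w. ?s w * (1 - worst_affinity \<gamma> (snd w)) \<partial>base)"
      using c d z by (intro nn_integral_mono mult_right_mono ennreal_leI real_sqrt_le_mono mult_mono)
        (auto simp del: space_base intro: less_imp_le joint_dens_pos \<gamma> \<theta>)
    finally have "(\<integral>\<^sup>+w. ?s w * worst_affinity \<gamma> (snd w) \<partial>base) + \<delta>
        \<le> (\<integral>\<^sup>+w. ?s w * worst_affinity \<gamma> (snd w) \<partial>base) + (\<integral>\<^sup>+w. ?s w * (1 - worst_affinity \<gamma> (snd w)) \<partial>base)"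
      by (rule add_left_mono)
    also have "\<dots> = (\<integral>\<^sup>+w. ?s w * worst_affinity \<gamma> (snd w) + ?s w * (1 - worst_affinity \<gamma> (snd w)) \<partial>base)"
      by (rule nn_integral_add[symmetric]) measurable
    also have "\<dots> = affinity \<gamma> z"
      unfolding affinity_def
    proof (rule nn_integral_cong)
      fix w assume "w \<in> space base"
      \<comment> \<open>Subtraction in \<open>ennreal\<close> is truncated at 0, so this bound is
        needed for the two terms to add up to one.\<close>
      then have "worst_affinity \<gamma> (snd w) \<le> 1"
        using worst_affinity_less_1[OF \<gamma>, of "snd w"] by (auto simp: less_imp_le)
      then have "worst_affinity \<gamma> (snd w) + (1 - worst_affinity \<gamma> (snd w)) = 1"
        using diff_add_cancel_ennreal by (simp add: add.commute)
      then show "?s w * worst_affinity \<gamma> (snd w) + ?s w * (1 - worst_affinity \<gamma> (snd w)) = ?s w"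
        by (simp only: distrib_left[symmetric] mult_1_right)
    qed
    also have "\<dots> \<le> 1" by (rule affinity_le_1[OF \<gamma>(1) z])
    finally show ?thesis .
  qed
  show thesis
  proof (rule that[of "1 - \<delta>"])
    show "1 - \<delta> < 1" using \<open>\<delta> \<noteq> 0\<close> by (intro ennreal_between) (auto simp: zero_less_iff_neq_zero)
    show "(\<integral>\<^sup>+w. ennreal (sqrt (joint_dens \<theta> z w * joint_dens \<gamma> z w)) * worst_affinity \<gamma> (snd w) \<partial>base) \<le> 1 - \<delta>"
      if "z \<in> adm_pairs M" for z
      using bound[OF that] by (simp add: ennreal_le_minus_iff)
  qed
qed

text \<open>The means \<open>a t\<close> do not increase, and over two steps they shrink by the
  factor \<open>\<rho>\<close>; so they decay geometrically along even times, and monotonicity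
  covers the odd ones.\<close>

lemma root_ratio_tendsto_0:
  assumes \<gamma>: "\<gamma> \<in> Params M" "\<gamma> \<noteq> \<theta>"
  shows "(\<lambda>t. \<integral>\<^sup>+\<omega>. ennreal (root_ratio \<gamma> t \<omega>) \<partial>P) \<longlonglongrightarrow> 0"
proof -
  obtain \<rho> where \<rho>: "\<rho> < 1" "\<And>z. z \<in> adm_pairs M \<Longrightarrow>
    (\<integral>\<^sup>+w. ennreal (sqrt (joint_dens \<theta> z w * joint_dens \<gamma> z w)) * worst_affinity \<gamma> (snd w) \<partial>base) \<le> \<rho>"
    using contraction[OF \<gamma>] by blast
  define a where "a t = (\<integral>\<^sup>+\<omega>. ennreal (root_ratio \<gamma> t \<omega>) \<partial>P)" for t
  have m [measurable]: "root_ratio \<gamma> t \<in> borel_measurable P" for t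
    by (rule measurable_from_subalg[OF subalgebra_FU root_ratio_FU[OF \<gamma>(1)]])
  have a_Suc: "a (Suc t) = (\<integral>\<^sup>+\<omega>. ennreal (root_ratio \<gamma> t \<omega>) * affinity \<gamma> (XU t \<omega>) \<partial>P)" for t
    using root_ratio_step[OF \<gamma>(1), of "\<lambda>_. 1" t] unfolding a_def affinity_def by simp
  have mono: "a (Suc t) \<le> a t" for t
    unfolding a_Suc unfolding a_def
  proof (rule nn_integral_mono)
    fix \<omega> assume "\<omega> \<in> space P"
    then show "ennreal (root_ratio \<gamma> t \<omega>) * affinity \<gamma> (XU t \<omega>) \<le> ennreal (root_ratio \<gamma> t \<omega>)"
      using mult_left_mono[OF affinity_le_1[OF \<gamma>(1) XU_adm], of \<omega> "ennreal (root_ratio \<gamma> t \<omega>)" t] by simp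
  qed
  \<comment> \<open>The affinity at time \<open>Suc t\<close> is dominated by a function of the next
    state before that state is integrated out from time \<open>t\<close>; only then does the uniform
    bound of \<open>contraction\<close> apply.\<close>
  have two: "a (Suc (Suc t)) \<le> \<rho> * a t" for t
  proof -
    have "a (Suc (Suc t)) \<le> (\<integral>\<^sup>+\<omega>. ennreal (root_ratio \<gamma> (Suc t) \<omega>) * worst_affinity \<gamma> (tX (Suc t) \<omega>) \<partial>P)"
      unfolding a_Suc by (intro nn_integral_mono mult_left_mono affinity_le_worst) simp_all
    also have "\<dots> = (\<integral>\<^sup>+\<omega>. ennreal (root_ratio \<gamma> t \<omega>) *
        (\<integral>\<^sup>+w. ennreal (sqrt (joint_dens \<theta> (XU t \<omega>) w * joint_dens \<gamma> (XU t \<omega>) w)) * worst_affinity \<gamma> (snd w) \<partial>base) \<partial>P)"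
      by (rule root_ratio_step[OF \<gamma>(1) worst_affinity_measurable[OF \<gamma>(1)]])
    also have "\<dots> \<le> (\<integral>\<^sup>+\<omega>. ennreal (root_ratio \<gamma> t \<omega>) * \<rho> \<partial>P)"
      by (intro nn_integral_mono mult_left_mono \<rho>(2)) simp_all
    also have "\<dots> = \<rho> * a t"
      unfolding a_def by (subst nn_integral_multc) (simp_all add: mult.commute)
    finally show ?thesis .
  qed
  have a0: "a 0 = 1" by (simp add: a_def P.emeasure_space_1)
  have pow: "a (2 * n) \<le> \<rho> ^ n" for n
  proof (induction n)
    case 0
    then show ?case by (simp add: a0)
  next
    case (Suc n)
    have "a (2 * Suc n) \<le> \<rho> * a (2 * n)" using two[of "2 * n"] by simp
    also have "\<dots> \<le> \<rho> * \<rho> ^ n" by (rule mult_left_mono[OF Suc.IH]) simp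
    finally show ?case by simp
  qed
  have le: "a t \<le> \<rho> ^ (t div 2)" for t
  proof (cases "even t")
    case True
    then show ?thesis using pow[of "t div 2"] by simp
  next
    case False
    then have "t = Suc (2 * (t div 2))" by presburger
    then show ?thesis using mono[of "2 * (t div 2)"] pow[of "t div 2"] by (metis order_trans)
  qed
  obtain r where r: "0 \<le> r" "\<rho> = ennreal r" using \<rho>(1) by (cases \<rho>) auto
  have "r < 1" using \<rho>(1) r by (simp add: ennreal_less_one_iff)
  have "filterlim (\<lambda>t::nat. t div 2) at_top sequentially"
    unfolding filterlim_at_top eventually_sequentially
    by (metis div_le_mono nonzero_mult_div_cancel_left zero_neq_numeral)
  from filterlim_compose[OF LIMSEQ_realpow_zero[OF r(1) \<open>r < 1\<close>] this]
  have "(\<lambda>t. ennreal (r ^ (t div 2))) \<longlonglongrightarrow> ennreal 0" by (rule tendsto_ennrealI)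
  then have "(\<lambda>t. \<rho> ^ (t div 2)) \<longlonglongrightarrow> 0" using r by (simp add: ennreal_power)
  then have "a \<longlonglongrightarrow> 0"
    by (rule tendsto_sandwich[OF _ _ tendsto_const, rotated 2]) (simp_all add: le)
  then show ?thesis by (simp add: a_def[abs_def])
qed

text \<open>With weights \<open>w\<close> (likelihood times prior), the posterior is at most min(1,
  x) for x = \<open>w \<gamma> / w \<theta>\<close>, because the normalizing sum exceeds both
  weights, and min(1, x) is at most sqrt x. The constant is the root of the prior odds, at
  \<open>x0\<close> because the initial state is almost surely \<open>x0\<close>.\<close>

lemma posterior_le:
  assumes \<gamma>: "\<gamma> \<in> Params M" "\<gamma> \<noteq> \<theta>"
  shows "AE \<omega> in P. posterior M \<pi>0 t \<omega> \<gamma> \<le> sqrt (\<pi>0 x0 \<gamma> / \<pi>0 x0 \<theta>) * root_ratio \<gamma> t \<omega>"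
    and "AE \<omega> in P. \<forall>\<gamma>\<in>Params M. 0 \<le> posterior M \<pi>0 t \<omega> \<gamma>"
proof -
  have \<pi>: "0 < \<pi>0 x0 \<gamma>'" if "\<gamma>' \<in> Params M" for \<gamma>'
    using prior x0 that by (simp add: is_prior_def)
  have L: "AE \<omega> in P. \<forall>\<gamma>'\<in>Params M. 0 < likelihood M \<gamma>' t \<omega>"
  proof (rule AE_finite_allI[OF Params_finite])
    show "AE \<omega> in P. 0 < likelihood M \<gamma>' t \<omega>" if "\<gamma>' \<in> Params M" for \<gamma>'
      using root_ratio_eq[OF that] by eventually_elim blast
  qed
  show "AE \<omega> in P. \<forall>\<gamma>\<in>Params M. 0 \<le> posterior M \<pi>0 t \<omega> \<gamma>"
    using L initial_state
  proof eventually_elim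
    case (elim \<omega>)
    show ?case
      unfolding posterior_def elim(2) using elim(1) \<pi>
      by (auto simp: less_imp_le intro!: divide_nonneg_nonneg sum_nonneg mult_nonneg_nonneg)
  qed
  show "AE \<omega> in P. posterior M \<pi>0 t \<omega> \<gamma> \<le> sqrt (\<pi>0 x0 \<gamma> / \<pi>0 x0 \<theta>) * root_ratio \<gamma> t \<omega>"
    using L initial_state root_ratio_eq[OF \<gamma>(1)]
  proof eventually_elim
    case (elim \<omega>)
    define w where "w \<gamma>' = likelihood M \<gamma>' t \<omega> * \<pi>0 x0 \<gamma>'" for \<gamma>'
    have w: "0 < w \<gamma>'" if "\<gamma>' \<in> Params M" for \<gamma>'
      using elim(1) \<pi> that by (simp add: w_def)
    define S where "S = sum w (Params M)"
    have S: "w \<gamma>' \<le> S" if "\<gamma>' \<in> Params M" for \<gamma>'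
      unfolding S_def using w that Params_finite by (intro member_le_sum) (auto intro: less_imp_le)
    have "w \<gamma> / S \<le> sqrt (w \<gamma> / w \<theta>)"
    proof (cases "w \<gamma> \<le> w \<theta>")
      case True
      have "w \<gamma> / S \<le> w \<gamma> / w \<theta>"
        using w[OF \<gamma>(1)] w[OF \<theta>] S[OF \<theta>] by (intro divide_left_mono) auto
      also have "\<dots> \<le> sqrt (w \<gamma> / w \<theta>)"
        using w[OF \<gamma>(1)] w[OF \<theta>] True
        by (intro real_le_rsqrt) (auto simp only: power2_eq_square intro!: mult_left_le; simp)
      finally show ?thesis .
    next
      case False
      have "w \<gamma> / S \<le> 1" using w[OF \<gamma>(1)] S[OF \<gamma>(1)] by simp
      also have "1 \<le> sqrt (w \<gamma> / w \<theta>)" using False w[OF \<theta>] by simp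
      finally show ?thesis .
    qed
    also have "sqrt (w \<gamma> / w \<theta>) = sqrt (\<pi>0 x0 \<gamma> / \<pi>0 x0 \<theta>) * root_ratio \<gamma> t \<omega>"
      using elim(3) by (simp add: w_def real_sqrt_mult real_sqrt_divide mult.commute)
    finally show ?case
      using elim(2) by (simp add: posterior_def w_def S_def)
  qed
qed

text \<open>The probability of drawing \<open>\<gamma>\<close> is the mean of its posterior weight.
  The computation runs through the conditional expectation \<open>?e\<close>, since the posterior is
  built from likelihoods at the played controls and need not be measurable itself.\<close>

lemma param_prob_le:
  assumes \<gamma>: "\<gamma> \<in> Params M" "\<gamma> \<noteq> \<theta>"
  shows "emeasure P {\<omega> \<in> space P. tTheta t \<omega> = \<gamma>}
    \<le> ennreal (sqrt (\<pi>0 x0 \<gamma> / \<pi>0 x0 \<theta>)) * (\<integral>\<^sup>+\<omega>. ennreal (root_ratio \<gamma> t \<omega>) \<partial>P)"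
proof -
  interpret F: finite_measure_subalgebra P "FH t" by unfold_locales (rule subalgebra_FH)
  let ?A = "tTheta t -` {\<gamma>} \<inter> space P"
  let ?e = "real_cond_exp P (FH t) (indicator ?A)"
  have A [measurable]: "?A \<in> sets P" by (rule measurable_sets[OF coordinates_P(2)]) (simp add: \<gamma>)
  have int: "integrable P (indicator ?A :: _ \<Rightarrow> real)"
    by (auto intro!: P.integrable_const_bound[where B = 1])
  have "AE \<omega> in P. ?e \<omega> = measure (point_measure (Params M) (\<lambda>\<gamma>. ennreal (posterior M \<pi>0 t \<omega> \<gamma>))) {\<gamma>}"
    using cond_law_param[of t] \<gamma> by (simp add: cond_law_def FH_def)
  \<comment> \<open>\<open>measure\<close> converts an \<open>ennreal\<close> back to a real, so the
    nonnegativity of the posterior is what recovers its value.\<close>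
  then have e: "AE \<omega> in P. ?e \<omega> = posterior M \<pi>0 t \<omega> \<gamma> \<and> 0 \<le> ?e \<omega>"
    using posterior_le(2)[OF \<gamma>, of t]
    by eventually_elim (simp add: measure_def emeasure_point_measure_finite Params_finite \<gamma>)
  have m [measurable]: "root_ratio \<gamma> t \<in> borel_measurable P"
    by (rule measurable_from_subalg[OF subalgebra_FU root_ratio_FU[OF \<gamma>(1)]])
  have "emeasure P {\<omega> \<in> space P. tTheta t \<omega> = \<gamma>} = emeasure P ?A"
    by (rule arg_cong[where f = "emeasure P"]) auto
  also have "\<dots> = ennreal (\<integral>\<omega>. indicator ?A \<omega> \<partial>P)"
    by (simp add: P.emeasure_eq_measure)
  also have "\<dots> = ennreal (\<integral>\<omega>. ?e \<omega> \<partial>P)"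
    using F.real_cond_exp_int(2)[OF int] by simp
  also have "\<dots> = (\<integral>\<^sup>+\<omega>. ennreal (?e \<omega>) \<partial>P)"
    by (rule nn_integral_eq_integral[symmetric]) (use F.real_cond_exp_int(1)[OF int] e in auto)
  also have "\<dots> \<le> (\<integral>\<^sup>+\<omega>. ennreal (sqrt (\<pi>0 x0 \<gamma> / \<pi>0 x0 \<theta>)) * ennreal (root_ratio \<gamma> t \<omega>) \<partial>P)"
  proof (rule nn_integral_mono_AE)
    have nonneg: "0 \<le> \<pi>0 x0 \<gamma> / \<pi>0 x0 \<theta>"
      using prior x0 \<gamma> by (auto simp: is_prior_def intro!: divide_nonneg_nonneg less_imp_le)
    show "AE \<omega> in P. ennreal (?e \<omega>) \<le> ennreal (sqrt (\<pi>0 x0 \<gamma> / \<pi>0 x0 \<theta>)) * ennreal (root_ratio \<gamma> t \<omega>)"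
      using e posterior_le(1)[OF \<gamma>, of t]
      by eventually_elim (simp add: ennreal_mult'[symmetric] ennreal_leI nonneg)
  qed
  also have "\<dots> = ennreal (sqrt (\<pi>0 x0 \<gamma> / \<pi>0 x0 \<theta>)) * (\<integral>\<^sup>+\<omega>. ennreal (root_ratio \<gamma> t \<omega>) \<partial>P)"
    by (rule nn_integral_cmult) measurable
  finally show ?thesis .
qed

lemma wrong_param_tendsto_0:
  "(\<lambda>t. measure P {\<omega> \<in> space P. tTheta t \<omega> \<noteq> \<theta>}) \<longlonglongrightarrow> 0"
proof -
  let ?B = "\<lambda>t. \<Sum>\<gamma>\<in>Params M - {\<theta>}.
    ennreal (sqrt (\<pi>0 x0 \<gamma> / \<pi>0 x0 \<theta>)) * (\<integral>\<^sup>+\<omega>. ennreal (root_ratio \<gamma> t \<omega>) \<partial>P)"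
  have "?B \<longlonglongrightarrow> (\<Sum>\<gamma>\<in>Params M - {\<theta>}. ennreal (sqrt (\<pi>0 x0 \<gamma> / \<pi>0 x0 \<theta>)) * 0)"
    by (intro tendsto_sum ennreal_tendsto_cmult root_ratio_tendsto_0) auto
  then have B: "?B \<longlonglongrightarrow> 0" by simp
  have le: "emeasure P {\<omega> \<in> space P. tTheta t \<omega> \<noteq> \<theta>} \<le> ?B t" for t
  proof -
    have m: "{\<omega> \<in> space P. tTheta t \<omega> = \<gamma>} \<in> sets P" if "\<gamma> \<in> Params M" for \<gamma>
    proof -
      have "tTheta t -` {\<gamma>} \<inter> space P \<in> sets P"
        by (rule measurable_sets[OF coordinates_P(2)]) (simp add: that)
      also have "tTheta t -` {\<gamma>} \<inter> space P = {\<omega> \<in> space P. tTheta t \<omega> = \<gamma>}" by auto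
      finally show ?thesis .
    qed
    have "{\<omega> \<in> space P. tTheta t \<omega> \<noteq> \<theta>} = (\<Union>\<gamma>\<in>Params M - {\<theta>}. {\<omega> \<in> space P. tTheta t \<omega> = \<gamma>})"
      by auto
    also have "emeasure P \<dots> \<le> (\<Sum>\<gamma>\<in>Params M - {\<theta>}. emeasure P {\<omega> \<in> space P. tTheta t \<omega> = \<gamma>})"
      using Params_finite m by (intro emeasure_subadditive_finite) auto
    also have "\<dots> \<le> ?B t" by (intro sum_mono param_prob_le) auto
    finally show ?thesis .
  qed
  have "(\<lambda>t. emeasure P {\<omega> \<in> space P. tTheta t \<omega> \<noteq> \<theta>}) \<longlonglongrightarrow> 0"
    by (rule tendsto_sandwich[OF _ _ tendsto_const B]) (simp_all add: le)
  then have "(\<lambda>t. ennreal (measure P {\<omega> \<in> space P. tTheta t \<omega> \<noteq> \<theta>})) \<longlonglongrightarrow> ennreal 0"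
    by (simp add: P.emeasure_eq_measure)
  then show ?thesis by (subst (asm) tendsto_ennreal_iff) auto
qed

section \<open>The residual regret\<close>

lemma FH_state: "tX t \<in> FH t \<rightarrow>\<^sub>M state_space M"
proof -
  have "(\<lambda>\<omega>. snd (tH t \<omega>)) \<in> FH t \<rightarrow>\<^sub>M state_space M"
    unfolding FH_def by (rule measurable_sigma_gen[OF tH_P hist_state])
  then show ?thesis by (simp add: tH_def)
qed

section \<open>Bounded values and rewards, and the discrepancy of the optimality equation\<close>

lemma value_measurable [measurable]: "\<nu> \<theta> \<in> borel_measurable (state_space M)"
  using policy(4)[OF \<theta>] by (simp add: bellman_solution_def)

lemma value_bounded:
  obtains B where "0 \<le> B" "\<And>x. x \<in> States M \<Longrightarrow> \<bar>\<nu> \<theta> x\<bar> \<le> B"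
proof -
  have "bounded (\<nu> \<theta> ` States M)"
    using policy(4)[OF \<theta>] unfolding bellman_solution_def by blast
  then obtain B where "\<And>x. x \<in> States M \<Longrightarrow> \<bar>\<nu> \<theta> x\<bar> \<le> B"
    by (auto simp: bounded_iff)
  moreover from this[OF x0] have "0 \<le> B" by linarith
  ultimately show thesis using that by blast
qed

lemma rewards_bounded:
  obtains K where "0 \<le> K" "\<And>r. r \<in> Rewards M \<Longrightarrow> \<bar>r\<bar> \<le> K"
  using compact_imp_bounded[OF Rewards_compact] unfolding bounded_pos by (auto intro: less_imp_le)

lemma ident_reward_space [measurable]: "(\<lambda>r. r) \<in> borel_measurable (reward_space M)"
  unfolding reward_space_def by (rule measurable_restrict_space1) simp

lemma expected_reward_eq:
  assumes "(x, u) \<in> adm_pairs M"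
  shows "expected_reward M \<theta> x u = (\<integral>r. r \<partial>reward_law M \<theta> x u)"
proof -
  note [measurable] = rew_dens_section[OF \<theta> assms]
  show ?thesis
    unfolding expected_reward_def reward_law_def
    by (subst integral_real_density) (auto intro!: AE_I2 rew_dens_nonneg assms simp: mult.commute)
qed

lemma transition_integral_eq:
  assumes "(x, u) \<in> adm_pairs M"
  shows "(\<integral>y. \<nu> \<theta> y \<partial>transition_law M \<theta> x u) = (\<integral>y. st_dens M \<theta> x u y * \<nu> \<theta> y \<partial>st_base M)"
proof -
  note [measurable] = st_dens_section[OF \<theta> assms]
  show ?thesis
    unfolding transition_law_def
    by (subst integral_real_density) (auto intro!: AE_I2 st_dens_nonneg assms)
qed

text \<open>This is the discrepancy function of Mandl.\<close>

definition discrepancy :: "'x \<times> 'u \<Rightarrow> real" where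
  "discrepancy z = \<nu> \<theta> (fst z) - bellman_rhs M \<theta> (\<nu> \<theta>) (fst z) (snd z)"

lemma discrepancy_optimal: "x \<in> States M \<Longrightarrow> discrepancy (x, \<mu> \<theta> x) = 0"
  using policy(3)[OF \<theta>] by (simp add: discrepancy_def)

lemma discrepancy_bounded:
  obtains C where "0 \<le> C" "\<And>z. z \<in> adm_pairs M \<Longrightarrow> \<bar>discrepancy z\<bar> \<le> C"
proof -
  obtain B where B: "0 \<le> B" "\<And>x. x \<in> States M \<Longrightarrow> \<bar>\<nu> \<theta> x\<bar> \<le> B" using value_bounded by blast
  obtain K where K: "0 \<le> K" "\<And>r. r \<in> Rewards M \<Longrightarrow> \<bar>r\<bar> \<le> K" using rewards_bounded by blast
  have "\<bar>discrepancy z\<bar> \<le> B + (K + disc M * B)" if z: "z \<in> adm_pairs M" for z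
  proof -
    obtain x u where zx: "z = (x, u)" by fastforce
    interpret R: prob_space "reward_law M \<theta> x u" using reward_law_prob z zx by simp
    interpret T: prob_space "transition_law M \<theta> x u" using transition_law_prob z zx by simp
    have m: "(\<lambda>r. r) \<in> borel_measurable (reward_law M \<theta> x u)"
      unfolding reward_law_def by measurable
    have m': "\<nu> \<theta> \<in> borel_measurable (transition_law M \<theta> x u)"
      unfolding transition_law_def by simp
    have 1: "\<bar>expected_reward M \<theta> x u\<bar> \<le> K"
      using R.abs_integral_le_const[OF m, of K] K z zx
      by (simp add: expected_reward_eq reward_law_def)
    have 2: "\<bar>\<integral>y. \<nu> \<theta> y \<partial>transition_law M \<theta> x u\<bar> \<le> B"
      by (rule T.abs_integral_le_const[OF m']) (simp add: transition_law_def B)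
    have 3: "\<bar>\<nu> \<theta> x\<bar> \<le> B" using z zx B by (simp add: adm_pairs_def)
    have "\<bar>disc M * (\<integral>y. \<nu> \<theta> y \<partial>transition_law M \<theta> x u)\<bar> \<le> disc M * B"
      using 2 disc_nonneg by (simp add: abs_mult mult_left_mono)
    with 1 3 show ?thesis
      by (simp add: discrepancy_def bellman_rhs_def zx)
  qed
  moreover have "0 \<le> B + (K + disc M * B)" using B K disc_nonneg by simp
  ultimately show thesis using that by blast
qed

text \<open>The tested form of the statement that, given \<open>FU t\<close>, the difference between
  the value now and the reward plus discounted next value has conditional mean
  \<open>discrepancy (XU t \<omega>)\<close>. The reward is averaged given \<open>FU\<close>, the
  next state given \<open>FR\<close>; the weight \<open>\<sigma>\<close> is measurable for
  both.\<close>

lemma integral_discrepancy: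
  assumes \<sigma> [measurable]: "\<sigma> \<in> borel_measurable (FU t)"
    and \<sigma>_le: "\<And>\<omega>. \<omega> \<in> space P \<Longrightarrow> \<bar>\<sigma> \<omega>\<bar> \<le> 1"
  shows "(\<integral>\<omega>. \<sigma> \<omega> * (\<nu> \<theta> (tX t \<omega>) - tR t \<omega> - disc M * \<nu> \<theta> (tX (Suc t) \<omega>)) \<partial>P)
    = (\<integral>\<omega>. \<sigma> \<omega> * discrepancy (XU t \<omega>) \<partial>P)"
    and "integrable P (\<lambda>\<omega>. \<sigma> \<omega> * discrepancy (XU t \<omega>))"
proof -
  obtain B where B: "0 \<le> B" "\<And>x. x \<in> States M \<Longrightarrow> \<bar>\<nu> \<theta> x\<bar> \<le> B" using value_bounded by blast
  obtain K where K: "0 \<le> K" "\<And>r. r \<in> Rewards M \<Longrightarrow> \<bar>r\<bar> \<le> K" using rewards_bounded by blast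
  define f where "f \<omega> r = rew_dens M \<theta> (fst (XU t \<omega>)) (snd (XU t \<omega>)) r" for \<omega> r
  define q where "q \<omega> y = st_dens M \<theta> (fst (XU t \<omega>)) (snd (XU t \<omega>)) y" for \<omega> y
  have fm: "(\<lambda>(\<omega>, r). f \<omega> r) \<in> borel_measurable (FU t \<Otimes>\<^sub>M rew_base M)"
  proof -
    have "(\<lambda>(\<omega>, r). f \<omega> r) \<in> borel_measurable (FU t \<Otimes>\<^sub>M reward_space M)"
      unfolding split_beta' f_def
      by (intro rew_dens_compose measurable_compose[OF measurable_fst XU_FU] \<theta>) measurable
    then show ?thesis by (simp add: sets_rew_base cong: measurable_cong_sets sets_pair_measure_cong)
  qed
  have qm: "(\<lambda>(\<omega>, y). q \<omega> y) \<in> borel_measurable (FR t \<Otimes>\<^sub>M st_base M)"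
  proof -
    have "(\<lambda>(\<omega>, y). q \<omega> y) \<in> borel_measurable (FR t \<Otimes>\<^sub>M state_space M)"
      unfolding split_beta' q_def
      by (intro st_dens_compose measurable_compose[OF measurable_fst XU_FR] \<theta>) measurable
    then show ?thesis by (simp add: sets_st_base cong: measurable_cong_sets sets_pair_measure_cong)
  qed
  note [measurable] = fm qm
  have \<sigma>P [measurable]: "\<sigma> \<in> borel_measurable P"
    by (rule measurable_from_subalg[OF subalgebra_FU \<sigma>])
  have \<sigma>R [measurable]: "\<sigma> \<in> borel_measurable (FR t)"
    by (rule measurable_subset_sets[OF FU_subset_FR _ \<sigma>]) simp
  have adm: "(fst (XU t \<omega>), snd (XU t \<omega>)) \<in> adm_pairs M" if "\<omega> \<in> space P" for \<omega>
    using that by simp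
  have fst_XU: "fst (XU t \<omega>) = tX t \<omega>" for \<omega> by (simp add: XU_def)
  have mR: "(\<lambda>\<omega>. expected_reward M \<theta> (fst (XU t \<omega>)) (snd (XU t \<omega>))) \<in> borel_measurable P"
    unfolding expected_reward_def f_def[symmetric]
    by (rule measurable_from_subalg[OF subalgebra_FU]) measurable
  have mT: "(\<lambda>\<omega>. \<integral>y. q \<omega> y * \<nu> \<theta> y \<partial>st_base M) \<in> borel_measurable P"
    by (rule measurable_from_subalg[OF subalgebra_FR]) measurable
  have R: "(\<integral>\<omega>. \<sigma> \<omega> * tR t \<omega> \<partial>P) = (\<integral>\<omega>. \<sigma> \<omega> * expected_reward M \<theta> (fst (XU t \<omega>)) (snd (XU t \<omega>)) \<partial>P)"
  proof -
    have "(\<integral>\<omega>. (\<lambda>(\<omega>, r). \<sigma> \<omega> * r) (\<omega>, tR t \<omega>) \<partial>P)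
        = (\<integral>\<omega>. (\<integral>r. (\<lambda>(\<omega>, r). f \<omega> r) (\<omega>, r) * (\<lambda>(\<omega>, r). \<sigma> \<omega> * r) (\<omega>, r) \<partial>rew_base M) \<partial>P)"
    proof (rule disintegration_integral[OF prob_space_P subalgebra_FU coordinates_P(4)
          sigma_finite_rew_base sets_rew_base fm, where C = K])
      show "distr P (FU t \<Otimes>\<^sub>M reward_space M) (\<lambda>\<omega>. (\<omega>, tR t \<omega>)) =
          density (restr_to_subalg P (FU t) \<Otimes>\<^sub>M rew_base M) (\<lambda>x. ennreal ((\<lambda>(\<omega>, r). f \<omega> r) x))"
        using reward_disintegration[of t] by (simp add: f_def split_beta')
      show "0 \<le> (\<lambda>(\<omega>, r). f \<omega> r) (\<omega>, r)" if "\<omega> \<in> space P" "r \<in> space (reward_space M)" for \<omega> r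
        using that adm by (auto simp: f_def intro: rew_dens_nonneg)
      show "\<bar>(\<lambda>(\<omega>, r). \<sigma> \<omega> * r) (\<omega>, r)\<bar> \<le> K" if "\<omega> \<in> space P" "r \<in> space (reward_space M)" for \<omega> r
        using mult_mono[OF \<sigma>_le[OF that(1)] K(2)[of r]] that by (simp add: abs_mult)
    qed measurable
    moreover have "(\<integral>r. f \<omega> r * (\<sigma> \<omega> * r) \<partial>rew_base M)
        = \<sigma> \<omega> * expected_reward M \<theta> (fst (XU t \<omega>)) (snd (XU t \<omega>))" for \<omega>
      unfolding expected_reward_def f_def integral_mult_right_zero[symmetric]
      by (rule Bochner_Integration.integral_cong) (simp_all add: mult_ac)
    ultimately show ?thesis by simp
  qed
  have T: "(\<integral>\<omega>. \<sigma> \<omega> * \<nu> \<theta> (tX (Suc t) \<omega>) \<partial>P) = (\<integral>\<omega>. \<sigma> \<omega> * (\<integral>y. q \<omega> y * \<nu> \<theta> y \<partial>st_base M) \<partial>P)"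
  proof -
    have "(\<integral>\<omega>. (\<lambda>(\<omega>, y). \<sigma> \<omega> * \<nu> \<theta> y) (\<omega>, tX (Suc t) \<omega>) \<partial>P)
        = (\<integral>\<omega>. (\<integral>y. (\<lambda>(\<omega>, y). q \<omega> y) (\<omega>, y) * (\<lambda>(\<omega>, y). \<sigma> \<omega> * \<nu> \<theta> y) (\<omega>, y) \<partial>st_base M) \<partial>P)"
    proof (rule disintegration_integral[OF prob_space_P subalgebra_FR coordinates_P(1)
          sigma_finite_st_base sets_st_base qm, where C = B])
      show "distr P (FR t \<Otimes>\<^sub>M state_space M) (\<lambda>\<omega>. (\<omega>, tX (Suc t) \<omega>)) =
          density (restr_to_subalg P (FR t) \<Otimes>\<^sub>M st_base M) (\<lambda>x. ennreal ((\<lambda>(\<omega>, y). q \<omega> y) x))"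
        using state_disintegration[of t] by (simp add: q_def split_beta')
      show "0 \<le> (\<lambda>(\<omega>, y). q \<omega> y) (\<omega>, y)" if "\<omega> \<in> space P" "y \<in> space (state_space M)" for \<omega> y
        using that adm by (auto simp: q_def intro: st_dens_nonneg)
      show "\<bar>(\<lambda>(\<omega>, y). \<sigma> \<omega> * \<nu> \<theta> y) (\<omega>, y)\<bar> \<le> B" if "\<omega> \<in> space P" "y \<in> space (state_space M)" for \<omega> y
        using mult_mono[OF \<sigma>_le[OF that(1)] B(2)[of y]] that by (simp add: abs_mult)
    qed measurable
    moreover have "(\<integral>y. q \<omega> y * (\<sigma> \<omega> * \<nu> \<theta> y) \<partial>st_base M) = \<sigma> \<omega> * (\<integral>y. q \<omega> y * \<nu> \<theta> y \<partial>st_base M)" for \<omega>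
      unfolding integral_mult_right_zero[symmetric]
      by (rule Bochner_Integration.integral_cong) (simp_all add: mult_ac)
    ultimately show ?thesis by simp
  qed
  have disc_eq: "discrepancy (XU t \<omega>) = \<nu> \<theta> (tX t \<omega>)
      - expected_reward M \<theta> (fst (XU t \<omega>)) (snd (XU t \<omega>)) - disc M * (\<integral>y. q \<omega> y * \<nu> \<theta> y \<partial>st_base M)"
    if "\<omega> \<in> space P" for \<omega>
    using transition_integral_eq[OF adm[OF that]]
    by (simp add: discrepancy_def bellman_rhs_def fst_XU q_def)
  obtain C where C: "0 \<le> C" "\<And>z. z \<in> adm_pairs M \<Longrightarrow> \<bar>discrepancy z\<bar> \<le> C"
    using discrepancy_bounded by blast
  have bd: "integrable P (\<lambda>\<omega>. \<sigma> \<omega> * g \<omega>)"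
    if [measurable]: "g \<in> borel_measurable P" and "\<And>\<omega>. \<omega> \<in> space P \<Longrightarrow> \<bar>g \<omega>\<bar> \<le> c" for g c
    using mult_mono[OF \<sigma>_le that(2)]
    by (intro P.integrable_const_bound[where B = c]) (auto simp: abs_mult intro!: AE_I2)
  have 1: "integrable P (\<lambda>\<omega>. \<sigma> \<omega> * \<nu> \<theta> (tX t \<omega>))" by (rule bd[of _ B]) (use B in auto)
  have 2: "integrable P (\<lambda>\<omega>. \<sigma> \<omega> * tR t \<omega>)"
    by (rule bd[of _ K]) (use K measurable_compose[OF coordinates_P(4)] in auto)
  have 3: "integrable P (\<lambda>\<omega>. \<sigma> \<omega> * \<nu> \<theta> (tX (Suc t) \<omega>))" by (rule bd[of _ B]) (use B in auto)
  have 4: "integrable P (\<lambda>\<omega>. \<sigma> \<omega> * expected_reward M \<theta> (fst (XU t \<omega>)) (snd (XU t \<omega>)))"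
  proof (rule bd[OF mR])
    fix \<omega> assume \<omega>: "\<omega> \<in> space P"
    interpret R: prob_space "reward_law M \<theta> (fst (XU t \<omega>)) (snd (XU t \<omega>))"
      using reward_law_prob[OF \<theta> adm[OF \<omega>]] .
    show "\<bar>expected_reward M \<theta> (fst (XU t \<omega>)) (snd (XU t \<omega>))\<bar> \<le> K"
      unfolding expected_reward_eq[OF adm[OF \<omega>]]
      by (rule R.abs_integral_le_const)
        (simp_all add: reward_law_def K cong: measurable_cong_sets[OF sets_rew_base])
  qed
  have 5: "integrable P (\<lambda>\<omega>. \<sigma> \<omega> * (\<integral>y. q \<omega> y * \<nu> \<theta> y \<partial>st_base M))"
  proof (rule bd[OF mT])
    fix \<omega> assume \<omega>: "\<omega> \<in> space P"
    interpret T: prob_space "transition_law M \<theta> (fst (XU t \<omega>)) (snd (XU t \<omega>))"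
      using transition_law_prob[OF \<theta> adm[OF \<omega>]] .
    show "\<bar>\<integral>y. q \<omega> y * \<nu> \<theta> y \<partial>st_base M\<bar> \<le> B"
      unfolding q_def transition_integral_eq[OF adm[OF \<omega>], symmetric]
      by (rule T.abs_integral_le_const) (simp_all add: transition_law_def B)
  qed
  have eq: "(\<integral>\<omega>. \<sigma> \<omega> * discrepancy (XU t \<omega>) \<partial>P)
     = (\<integral>\<omega>. \<sigma> \<omega> * \<nu> \<theta> (tX t \<omega>) - \<sigma> \<omega> * expected_reward M \<theta> (fst (XU t \<omega>)) (snd (XU t \<omega>))
         - disc M * (\<sigma> \<omega> * (\<integral>y. q \<omega> y * \<nu> \<theta> y \<partial>st_base M)) \<partial>P)"
    by (rule Bochner_Integration.integral_cong) (simp_all add: disc_eq algebra_simps)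
  have "(\<integral>\<omega>. \<sigma> \<omega> * (\<nu> \<theta> (tX t \<omega>) - tR t \<omega> - disc M * \<nu> \<theta> (tX (Suc t) \<omega>)) \<partial>P)
     = (\<integral>\<omega>. \<sigma> \<omega> * \<nu> \<theta> (tX t \<omega>) - \<sigma> \<omega> * tR t \<omega> - disc M * (\<sigma> \<omega> * \<nu> \<theta> (tX (Suc t) \<omega>)) \<partial>P)"
    by (rule Bochner_Integration.integral_cong) (simp_all add: algebra_simps)
  also have "\<dots> = (\<integral>\<omega>. \<sigma> \<omega> * discrepancy (XU t \<omega>) \<partial>P)"
    unfolding eq using 1 2 3 4 5 R T by simp
  finally show "(\<integral>\<omega>. \<sigma> \<omega> * (\<nu> \<theta> (tX t \<omega>) - tR t \<omega> - disc M * \<nu> \<theta> (tX (Suc t) \<omega>)) \<partial>P)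
    = (\<integral>\<omega>. \<sigma> \<omega> * discrepancy (XU t \<omega>) \<partial>P)" .
  have "integrable P (\<lambda>\<omega>. \<sigma> \<omega> * \<nu> \<theta> (tX t \<omega>) - \<sigma> \<omega> * expected_reward M \<theta> (fst (XU t \<omega>)) (snd (XU t \<omega>))
         - disc M * (\<sigma> \<omega> * (\<integral>y. q \<omega> y * \<nu> \<theta> y \<partial>st_base M)))"
    using 1 4 5 by simp
  then show "integrable P (\<lambda>\<omega>. \<sigma> \<omega> * discrepancy (XU t \<omega>))"
    by (rule Bochner_Integration.integrable_cong[THEN iffD1, rotated 2])
      (simp_all add: disc_eq algebra_simps)
qed

lemma wrong_param_sets: "{\<omega> \<in> space P. tTheta t \<omega> \<noteq> \<theta>} \<in> sets P"
proof -
  have "tTheta t -` (Params M - {\<theta>}) \<inter> space P \<in> sets P"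
    by (rule measurable_sets[OF coordinates_P(2)]) simp
  also have "tTheta t -` (Params M - {\<theta>}) \<inter> space P = {\<omega> \<in> space P. tTheta t \<omega> \<noteq> \<theta>}" by auto
  finally show ?thesis .
qed

text \<open>On the event that \<open>\<theta>\<close> is drawn the recommended control is optimal
  and the discrepancy is zero; elsewhere it is bounded. One \<open>C\<close> serves all times and
  weights, which the later summation over time requires.\<close>

lemma integral_discrepancy_le:
  obtains C where "0 \<le> C" "\<And>t \<sigma>. \<sigma> \<in> borel_measurable (FU t) \<Longrightarrow>
      (\<And>\<omega>. \<omega> \<in> space P \<Longrightarrow> \<bar>\<sigma> \<omega>\<bar> \<le> 1) \<Longrightarrow>
      (\<integral>\<omega>. \<sigma> \<omega> * (\<nu> \<theta> (tX t \<omega>) - tR t \<omega> - disc M * \<nu> \<theta> (tX (Suc t) \<omega>)) \<partial>P)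
      \<le> C * measure P {\<omega> \<in> space P. tTheta t \<omega> \<noteq> \<theta>}"
proof -
  obtain C where C: "0 \<le> C" "\<And>z. z \<in> adm_pairs M \<Longrightarrow> \<bar>discrepancy z\<bar> \<le> C"
    using discrepancy_bounded by blast
  have "(\<integral>\<omega>. \<sigma> \<omega> * (\<nu> \<theta> (tX t \<omega>) - tR t \<omega> - disc M * \<nu> \<theta> (tX (Suc t) \<omega>)) \<partial>P)
      \<le> C * measure P {\<omega> \<in> space P. tTheta t \<omega> \<noteq> \<theta>}"
    if \<sigma>: "\<sigma> \<in> borel_measurable (FU t)" "\<And>\<omega>. \<omega> \<in> space P \<Longrightarrow> \<bar>\<sigma> \<omega>\<bar> \<le> 1" for \<sigma> t
  proof -
    note [measurable] = wrong_param_sets[of t]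
    let ?N = "{\<omega> \<in> space P. tTheta t \<omega> \<noteq> \<theta>}"
    have "(\<integral>\<omega>. \<sigma> \<omega> * discrepancy (XU t \<omega>) \<partial>P) \<le> (\<integral>\<omega>. C * indicator ?N \<omega> \<partial>P)"
    proof (rule integral_mono)
      show "integrable P (\<lambda>\<omega>. \<sigma> \<omega> * discrepancy (XU t \<omega>))"
        by (rule integral_discrepancy(2)[OF \<sigma>])
      show "integrable P (\<lambda>\<omega>. C * indicator ?N \<omega>)"
        by (intro P.integrable_const_bound[where B = C]) (auto simp: C indicator_def intro!: AE_I2)
      fix \<omega> assume \<omega>: "\<omega> \<in> space P"
      show "\<sigma> \<omega> * discrepancy (XU t \<omega>) \<le> C * indicator ?N \<omega>"
      proof (cases "tTheta t \<omega> = \<theta>")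
        case True
        then show ?thesis using \<omega> by (simp add: XU_def discrepancy_optimal)
      next
        case False
        have "\<sigma> \<omega> * discrepancy (XU t \<omega>) \<le> \<bar>\<sigma> \<omega>\<bar> * \<bar>discrepancy (XU t \<omega>)\<bar>"
          by (simp add: abs_mult[symmetric])
        also have "\<dots> \<le> 1 * C" using \<sigma>(2)[OF \<omega>] C(2)[OF XU_adm[OF \<omega>]] by (intro mult_mono) auto
        finally show ?thesis using False \<omega> by simp
      qed
    qed
    then show ?thesis using integral_discrepancy(1)[OF \<sigma>] by simp
  qed
  with C(1) show thesis using that by blast
qed

section \<open>From one-step discrepancies to the $L^1$ norm of the residual regret\<close>

lemma residual_regret_FH: "residual_regret M \<nu> \<theta> P n \<in> borel_measurable (FH n)"
  unfolding residual_regret_def[abs_def] FH_def[symmetric]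
  by (intro borel_measurable_diff measurable_compose[OF FH_state value_measurable] borel_measurable_cond_exp)

lemma residual_regret_P: "residual_regret M \<nu> \<theta> P n \<in> borel_measurable P"
  by (rule measurable_from_subalg[OF subalgebra_FH residual_regret_FH])

text \<open>A pathwise identity: the discounted values telescope, and the remainder vanishes because
  the values are bounded and the discount factor is below one.\<close>

lemma discounted_telescope:
  assumes \<omega>: "\<omega> \<in> space P"
  shows "(\<lambda>k. disc M ^ k * (\<nu> \<theta> (tX (n + k) \<omega>) - tR (n + k) \<omega> - disc M * \<nu> \<theta> (tX (Suc (n + k)) \<omega>)))
    sums (\<nu> \<theta> (tX n \<omega>) - (\<Sum>k. disc M ^ k * tR (n + k) \<omega>))"
proof -
  obtain B where B: "0 \<le> B" "\<And>x. x \<in> States M \<Longrightarrow> \<bar>\<nu> \<theta> x\<bar> \<le> B" using value_bounded by blast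
  obtain K where K: "0 \<le> K" "\<And>r. r \<in> Rewards M \<Longrightarrow> \<bar>r\<bar> \<le> K" using rewards_bounded by blast
  have geo: "summable (\<lambda>k. disc M ^ k)" "(\<lambda>k. disc M ^ k) \<longlonglongrightarrow> 0"
    using disc_nonneg disc_less_1 by (auto intro: summable_geometric LIMSEQ_realpow_zero)
  have "summable (\<lambda>k. disc M ^ k * tR (n + k) \<omega>)"
    by (rule summable_comparison_test'[OF summable_mult2[OF geo(1), of K], of 0])
      (use disc_nonneg K \<omega> in \<open>auto simp: abs_mult intro!: mult_left_mono\<close>)
  then have 1: "(\<lambda>k. disc M ^ k * tR (n + k) \<omega>) sums (\<Sum>k. disc M ^ k * tR (n + k) \<omega>)"
    by (rule summable_sums)
  have "(\<lambda>k. disc M ^ k * \<nu> \<theta> (tX (n + k) \<omega>)) \<longlonglongrightarrow> 0"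
  proof (rule tendsto_rabs_zero_cancel, rule tendsto_sandwich[OF _ _ tendsto_const])
    show "(\<lambda>k. disc M ^ k * B) \<longlonglongrightarrow> 0" using tendsto_mult_left_zero[OF geo(2)] .
    show "\<forall>\<^sub>F k in sequentially. \<bar>disc M ^ k * \<nu> \<theta> (tX (n + k) \<omega>)\<bar> \<le> disc M ^ k * B"
      using disc_nonneg B \<omega> by (auto simp: abs_mult intro!: mult_left_mono always_eventually)
  qed simp
  from telescope_sums'[OF this]
  have 2: "(\<lambda>k. disc M ^ k * \<nu> \<theta> (tX (n + k) \<omega>) - disc M ^ Suc k * \<nu> \<theta> (tX (n + Suc k) \<omega>))
      sums \<nu> \<theta> (tX n \<omega>)"
    by simp
  from sums_diff[OF 2 1] show ?thesis by (simp add: algebra_simps)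
qed

text \<open>Each step contributes at most a constant times the probability of a wrong draw, and the
  discount weights sum to 1 / (1 - \<open>disc M\<close>). Integrability is part of the conclusion
  because a Bochner integral that does not exist is 0 by default, which would make the bound
  empty.\<close>

lemma residual_regret_L1:
  obtains C where "0 \<le> C" "\<And>n \<epsilon>. (\<And>t. n \<le> t \<Longrightarrow> measure P {\<omega> \<in> space P. tTheta t \<omega> \<noteq> \<theta>} \<le> \<epsilon>) \<Longrightarrow>
    integrable P (residual_regret M \<nu> \<theta> P n) \<and>
    (\<integral>\<omega>. \<bar>residual_regret M \<nu> \<theta> P n \<omega>\<bar> \<partial>P) \<le> C * \<epsilon>"
proof -
  obtain B where B: "0 \<le> B" "\<And>x. x \<in> States M \<Longrightarrow> \<bar>\<nu> \<theta> x\<bar> \<le> B" using value_bounded by blast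
  obtain K where K: "0 \<le> K" "\<And>r. r \<in> Rewards M \<Longrightarrow> \<bar>r\<bar> \<le> K" using rewards_bounded by blast
  obtain C where C: "0 \<le> C" "\<And>t \<sigma>. \<sigma> \<in> borel_measurable (FU t) \<Longrightarrow>
      (\<And>\<omega>. \<omega> \<in> space P \<Longrightarrow> \<bar>\<sigma> \<omega>\<bar> \<le> 1) \<Longrightarrow>
      (\<integral>\<omega>. \<sigma> \<omega> * (\<nu> \<theta> (tX t \<omega>) - tR t \<omega> - disc M * \<nu> \<theta> (tX (Suc t) \<omega>)) \<partial>P)
      \<le> C * measure P {\<omega> \<in> space P. tTheta t \<omega> \<noteq> \<theta>}"
    using integral_discrepancy_le by blast
  have geo: "summable (\<lambda>k. disc M ^ k)"
    using disc_nonneg disc_less_1 by (auto intro: summable_geometric)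
  have tR_m [measurable]: "tR t \<in> borel_measurable P" for t
    by (rule measurable_compose[OF coordinates_P(4) ident_reward_space])
  show thesis
  proof (rule that[of "C / (1 - disc M)"])
    show "0 \<le> C / (1 - disc M)" using C(1) disc_less_1 by simp
    fix n :: nat and \<epsilon> :: real
    assume \<epsilon>: "\<And>t. n \<le> t \<Longrightarrow> measure P {\<omega> \<in> space P. tTheta t \<omega> \<noteq> \<theta>} \<le> \<epsilon>"
    interpret F: finite_measure_subalgebra P "FH n" by unfold_locales (rule subalgebra_FH)
    let ?R = "residual_regret M \<nu> \<theta> P n"
    let ?S = "\<lambda>\<omega>. \<Sum>k. disc M ^ k * tR (n + k) \<omega>"
    let ?D = "\<lambda>t \<omega>. \<nu> \<theta> (tX t \<omega>) - tR t \<omega> - disc M * \<nu> \<theta> (tX (Suc t) \<omega>)"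
    note [measurable] = residual_regret_P
    have \<nu>_int: "integrable P (\<lambda>\<omega>. \<nu> \<theta> (tX n \<omega>))"
      by (rule P.integrable_const_bound[where B = B]) (auto simp: B intro!: AE_I2)
    have D_le: "\<bar>?D t \<omega>\<bar> \<le> B + K + disc M * B" if \<omega>: "\<omega> \<in> space P" for t \<omega>
    proof -
      have "\<bar>disc M * \<nu> \<theta> (tX (Suc t) \<omega>)\<bar> \<le> disc M * B"
        using disc_nonneg B \<omega> by (auto simp: abs_mult intro!: mult_left_mono)
      then show ?thesis using B(2)[of "tX t \<omega>"] K(2)[of "tR t \<omega>"] \<omega> by simp
    qed
    \<comment> \<open>The telescoped series gives a uniform pathwise bound; integrability of the
      discounted reward sum then follows by subtraction from the value.\<close>
    have V_int: "integrable P (\<lambda>\<omega>. \<nu> \<theta> (tX n \<omega>) - ?S \<omega>)"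
    proof (rule P.integrable_const_bound[where B = "(B + K + disc M * B) / (1 - disc M)"])
      show "AE \<omega> in P. norm (\<nu> \<theta> (tX n \<omega>) - ?S \<omega>) \<le> (B + K + disc M * B) / (1 - disc M)"
      proof (rule AE_I2)
        fix \<omega> assume \<omega>: "\<omega> \<in> space P"
        have "norm (\<nu> \<theta> (tX n \<omega>) - ?S \<omega>) \<le> (\<Sum>k. disc M ^ k * (B + K + disc M * B))"
          unfolding sums_unique[OF discounted_telescope[OF \<omega>, of n]]
          using disc_nonneg D_le[OF \<omega>]
          by (intro norm_suminf_le summable_mult2[OF geo]) (auto simp: abs_mult intro!: mult_left_mono)
        also have "\<dots> = (B + K + disc M * B) / (1 - disc M)"
          using disc_nonneg disc_less_1 by (simp add: suminf_mult2[symmetric] geo suminf_geometric)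
        finally show "norm (\<nu> \<theta> (tX n \<omega>) - ?S \<omega>) \<le> (B + K + disc M * B) / (1 - disc M)" .
      qed
    qed measurable
    have S_int: "integrable P ?S"
      using Bochner_Integration.integrable_diff[OF \<nu>_int V_int] by simp
    have R_eq: "?R \<omega> = \<nu> \<theta> (tX n \<omega>) - real_cond_exp P (FH n) ?S \<omega>" for \<omega>
      by (simp add: residual_regret_def FH_def)
    have R_int: "integrable P ?R"
      unfolding R_eq[abs_def] using \<nu>_int F.real_cond_exp_int(1)[OF S_int] by simp
    \<comment> \<open>Testing against the sign removes the conditional expectation from the $L^1$ norm.\<close>
    define \<sigma> where "\<sigma> \<omega> = sgn (?R \<omega>)" for \<omega>
    have \<sigma>H: "\<sigma> \<in> borel_measurable (FH n)"
      unfolding \<sigma>_def by (rule measurable_compose[OF residual_regret_FH]) measurable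
    have \<sigma>P [measurable]: "\<sigma> \<in> borel_measurable P"
      by (rule measurable_from_subalg[OF subalgebra_FH \<sigma>H])
    have \<sigma>_le: "\<bar>\<sigma> \<omega>\<bar> \<le> 1" for \<omega> by (simp add: \<sigma>_def sgn_if)
    have \<sigma>_int: "integrable P (\<lambda>\<omega>. \<sigma> \<omega> * g \<omega>)" if "integrable P g" for g
      using that \<sigma>_le
      by (intro Bochner_Integration.integrable_bound[OF that]) (auto simp: abs_mult intro!: AE_I2 mult_left_le_one_le)
    have "(\<integral>\<omega>. \<bar>?R \<omega>\<bar> \<partial>P) = (\<integral>\<omega>. \<sigma> \<omega> * \<nu> \<theta> (tX n \<omega>) - \<sigma> \<omega> * real_cond_exp P (FH n) ?S \<omega> \<partial>P)"
    proof (rule Bochner_Integration.integral_cong)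
      fix \<omega>
      have "\<bar>?R \<omega>\<bar> = \<sigma> \<omega> * ?R \<omega>" by (simp add: \<sigma>_def abs_sgn mult.commute)
      also have "\<dots> = \<sigma> \<omega> * \<nu> \<theta> (tX n \<omega>) - \<sigma> \<omega> * real_cond_exp P (FH n) ?S \<omega>"
        by (simp only: R_eq right_diff_distrib)
      finally show "\<bar>?R \<omega>\<bar> = \<dots>" .
    qed simp
    also have "\<dots> = (\<integral>\<omega>. \<sigma> \<omega> * \<nu> \<theta> (tX n \<omega>) \<partial>P) - (\<integral>\<omega>. \<sigma> \<omega> * ?S \<omega> \<partial>P)"
      using F.real_cond_exp_intg[OF \<sigma>_int[OF S_int] \<sigma>H] \<sigma>_int[OF \<nu>_int] by simp
    also have "\<dots> = (\<integral>\<omega>. \<sigma> \<omega> * (\<nu> \<theta> (tX n \<omega>) - ?S \<omega>) \<partial>P)"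
      using \<sigma>_int[OF \<nu>_int] \<sigma>_int[OF S_int] by (simp add: right_diff_distrib)
    also have "\<dots> = (\<integral>\<omega>. (\<Sum>k. disc M ^ k * (\<sigma> \<omega> * ?D (n + k) \<omega>)) \<partial>P)"
    proof (rule Bochner_Integration.integral_cong)
      fix \<omega> assume "\<omega> \<in> space P"
      from sums_unique[OF sums_mult[OF discounted_telescope[OF this, of n], of "\<sigma> \<omega>"]]
      show "\<sigma> \<omega> * (\<nu> \<theta> (tX n \<omega>) - ?S \<omega>) = (\<Sum>k. disc M ^ k * (\<sigma> \<omega> * ?D (n + k) \<omega>))"
        by (simp add: mult.left_commute)
    qed simp
    also have "\<dots> = (\<Sum>k. \<integral>\<omega>. disc M ^ k * (\<sigma> \<omega> * ?D (n + k) \<omega>) \<partial>P)"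
    proof (rule integral_suminf)
      have le: "norm (disc M ^ k * (\<sigma> \<omega> * ?D (n + k) \<omega>)) \<le> disc M ^ k * (B + K + disc M * B)"
        if "\<omega> \<in> space P" for k \<omega>
        using disc_nonneg mult_mono[OF \<sigma>_le[of \<omega>] D_le[OF that, of "n + k"]]
        by (auto simp: abs_mult intro!: mult_left_mono)
      show int: "integrable P (\<lambda>\<omega>. disc M ^ k * (\<sigma> \<omega> * ?D (n + k) \<omega>))" for k
        by (rule P.integrable_const_bound[where B = "disc M ^ k * (B + K + disc M * B)"])
          (use le in \<open>auto intro!: AE_I2\<close>)
      show "AE \<omega> in P. summable (\<lambda>k. norm (disc M ^ k * (\<sigma> \<omega> * ?D (n + k) \<omega>)))"
        by (rule AE_I2, rule summable_comparison_test'[OF summable_mult2[OF geo], of 0])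
          (use le in auto)
      show "summable (\<lambda>k. \<integral>\<omega>. norm (disc M ^ k * (\<sigma> \<omega> * ?D (n + k) \<omega>)) \<partial>P)"
      proof (rule summable_comparison_test'[OF summable_mult2[OF geo, of "B + K + disc M * B"], of 0])
        fix k :: nat
        show "norm (\<integral>\<omega>. norm (disc M ^ k * (\<sigma> \<omega> * ?D (n + k) \<omega>)) \<partial>P) \<le> disc M ^ k * (B + K + disc M * B)"
          unfolding real_norm_def
          by (rule P.abs_integral_le_const) (use le in \<open>auto\<close>)
      qed
    qed
    also have "\<dots> \<le> (\<Sum>k. disc M ^ k * (C * \<epsilon>))"
    proof (rule suminf_le)
      fix k
      have "\<sigma> \<in> borel_measurable (FU (n + k))"
        by (rule measurable_subset_sets[OF FH_subset_FU _ \<sigma>H]) simp_all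
      then have "(\<integral>\<omega>. \<sigma> \<omega> * ?D (n + k) \<omega> \<partial>P) \<le> C * measure P {\<omega> \<in> space P. tTheta (n + k) \<omega> \<noteq> \<theta>}"
        by (rule C(2)) (rule \<sigma>_le)
      also have "\<dots> \<le> C * \<epsilon>" using C(1) by (intro mult_left_mono \<epsilon>) simp_all
      finally show "(\<integral>\<omega>. disc M ^ k * (\<sigma> \<omega> * ?D (n + k) \<omega>) \<partial>P) \<le> disc M ^ k * (C * \<epsilon>)"
        using disc_nonneg by (simp add: mult_left_mono)
    next
      show "summable (\<lambda>k. \<integral>\<omega>. disc M ^ k * (\<sigma> \<omega> * ?D (n + k) \<omega>) \<partial>P)"
      proof (rule summable_comparison_test'[OF summable_mult2[OF geo, of "B + K + disc M * B"], of 0])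
        fix k :: nat
        show "norm (\<integral>\<omega>. disc M ^ k * (\<sigma> \<omega> * ?D (n + k) \<omega>) \<partial>P) \<le> disc M ^ k * (B + K + disc M * B)"
          unfolding real_norm_def
        proof (rule P.abs_integral_le_const)
          fix \<omega> assume "\<omega> \<in> space P"
          then show "\<bar>disc M ^ k * (\<sigma> \<omega> * ?D (n + k) \<omega>)\<bar> \<le> disc M ^ k * (B + K + disc M * B)"
            using disc_nonneg mult_mono[OF \<sigma>_le[of \<omega>] D_le[of \<omega> "n + k"]]
            by (auto simp: abs_mult intro!: mult_left_mono)
        qed measurable
      qed
      show "summable (\<lambda>k. disc M ^ k * (C * \<epsilon>))" by (rule summable_mult2[OF geo])
    qed
    also have "\<dots> = C / (1 - disc M) * \<epsilon>"
      using disc_nonneg disc_less_1 by (simp add: suminf_mult2[symmetric] geo suminf_geometric)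
    finally show "integrable P ?R \<and> (\<integral>\<omega>. \<bar>?R \<omega>\<bar> \<partial>P) \<le> C / (1 - disc M) * \<epsilon>"
      using R_int by simp
  qed
qed

lemma residual_regret_L1_tendsto_0:
  "(\<lambda>n. \<integral>\<^sup>+\<omega>. ennreal \<bar>residual_regret M \<nu> \<theta> P n \<omega>\<bar> \<partial>P) \<longlonglongrightarrow> 0"
proof -
  obtain C where C: "0 \<le> C" "\<And>n \<epsilon>. (\<And>t. n \<le> t \<Longrightarrow> measure P {\<omega> \<in> space P. tTheta t \<omega> \<noteq> \<theta>} \<le> \<epsilon>) \<Longrightarrow>
    integrable P (residual_regret M \<nu> \<theta> P n) \<and>
    (\<integral>\<omega>. \<bar>residual_regret M \<nu> \<theta> P n \<omega>\<bar> \<partial>P) \<le> C * \<epsilon>"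
    using residual_regret_L1 by blast
  let ?I = "\<lambda>n. \<integral>\<omega>. \<bar>residual_regret M \<nu> \<theta> P n \<omega>\<bar> \<partial>P"
  \<comment> \<open>The choice \<open>\<epsilon> = 1\<close> always satisfies the premise, as a
    probability is at most one.\<close>
  have int: "integrable P (residual_regret M \<nu> \<theta> P n)" for n
    using C(2)[of n 1] by simp
  have "?I \<longlonglongrightarrow> 0"
  proof (rule LIMSEQ_I)
    fix e :: real assume "0 < e"
    \<comment> \<open>Dividing by \<open>C + 1\<close> covers the case \<open>C = 0\<close> and
      makes the final inequality strict.\<close>
    then have "0 < e / (C + 1)" using C(1) by simp
    from LIMSEQ_D[OF wrong_param_tendsto_0 this]
    obtain N where N: "\<And>t. N \<le> t \<Longrightarrow> measure P {\<omega> \<in> space P. tTheta t \<omega> \<noteq> \<theta>} < e / (C + 1)" by auto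
    have "norm (?I n - 0) < e" if "N \<le> n" for n
    proof -
      have "measure P {\<omega> \<in> space P. tTheta t \<omega> \<noteq> \<theta>} \<le> e / (C + 1)" if "n \<le> t" for t
        using N[of t] that \<open>N \<le> n\<close> by simp
      then have "?I n \<le> C * (e / (C + 1))" using C(2) by blast
      also have "\<dots> < e" using \<open>0 < e\<close> C(1) by (simp add: field_simps)
      finally show ?thesis by simp
    qed
    then show "\<exists>N. \<forall>n\<ge>N. norm (?I n - 0) < e" by blast
  qed
  then have "(\<lambda>n. ennreal (?I n)) \<longlonglongrightarrow> ennreal 0" by (rule tendsto_ennrealI)
  moreover have "(\<integral>\<^sup>+\<omega>. ennreal \<bar>residual_regret M \<nu> \<theta> P n \<omega>\<bar> \<partial>P) = ennreal (?I n)" for n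
    by (rule nn_integral_eq_integral) (use int in auto)
  ultimately show ?thesis by simp
qed

end

theorem corollary6p2:
  fixes M :: "('x::polish_space, 'u::polish_space, 'p) control_model"
    and \<nu> :: "'p \<Rightarrow> 'x \<Rightarrow> real"
    and \<mu> :: "'p \<Rightarrow> 'x \<Rightarrow> 'u"
    and \<pi>0 :: "'x \<Rightarrow> 'p \<Rightarrow> real"
    and \<theta> :: 'p
    and x0 :: 'x
    and P :: "('x, 'u, 'p) ts_traj measure"
  assumes "valid_model M"
    and "\<theta> \<in> Params M"
    and "optimality_assumption M \<nu> \<mu>"
    and "is_prior M \<pi>0"
    and "x0 \<in> States M"
    and "thompson_law M \<pi>0 \<mu> \<theta> x0 P"
    and "identifiability_assumption M \<theta>"
    and "AE \<omega> in P. \<exists>L. (\<lambda>n. residual_regret M \<nu> \<theta> P n \<omega>) \<longlonglongrightarrow> L"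
  shows "AE \<omega> in P. (\<lambda>n. residual_regret M \<nu> \<theta> P n \<omega>) \<longlonglongrightarrow> 0"
proof -
  interpret thompson_sampling M \<nu> \<mu> \<pi>0 \<theta> x0 P
    by (intro thompson_sampling.intro thompson_sampling_axioms.intro assms)
  \<comment> \<open>Here the assumed almost sure convergence enters: it upgrades convergence to zero
    in $L^1$ to almost sure convergence of the whole sequence.\<close>
  show ?thesis
    by (rule AE_tendsto_0_of_nn_integral[OF residual_regret_P residual_regret_L1_tendsto_0 assms(8)])
qed

end
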